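(* Let $a,b$ be computable real numbers with $a>1$ and $b>0$, and let $\mathcal{R}=\mathcal{R}_1\times\mathcal{R}_2$ with $\mathcal{R}_1=[-a,a]$ and $\mathcal{R}_2=[-b,b]$. There exists a computable continuous function $f_1:\mathcal{R}\to\mathbb{R}$ with the following properties: (1) For every fixed $x_2\in\mathcal{R}_2$, the function $f_1(\cdot,x_2):\mathcal{R}_1\to\mathbb{R}$ is convex and piecewise linear (with 3 linear pieces), and it is a computable continuous function whenever $x_2$ is a computable number. (2) For every fixed $x_1\in\mathcal{R}_1$, the function $f_1(x_1,\cdot):\mathcal{R}_2\to\mathbb{R}$ is convex and piecewise linear (with 2 linear pieces), and it is a computable continuous function whenever $x_1$ is a computable number. (3) $f_1$ has only global minima on $\mathcal{R}$ (i.e. every local minimizer of $f_1$ on $\mathcal{R}$ is a global minimizer), and the set of all global minimizers of $f_1$ on $\mathcal{R}$ is convex. (4) For every $x_2\in\mathcal{R}_2$ with $x_2\neq 0$, the function $f_1(\cdot,x_2)$ has exactly one global minimizer on $\mathcal{R}_1$. (5) No assignment function $G_1\in\mathcal{A}_1(f_1)$ is Turing computable.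
   Context: Computability notions. A sequence (or double sequence) of rational numbers is computable if it is generated by a Turing machine from its index (indices). A real number $x$ is computable if there is a computable sequence $\{r_k\}_{k\in\mathbb{N}}\subset\mathbb{Q}$ with $|x-r_k|\le 2^{-k}$ for all $k$; such a sequence is called a representation of $x$. A vector in $\mathbb{R}^m$ is computable if all its components are; a representation of a vector consists of representations of its components. A sequence $\{x_n\}$ of reals is computable if there is a computable double sequence $\{r_{n,k}\}\subset\mathbb{Q}$ with $|x_n-r_{n,k}|<2^{-k}$ for all $n,k$; a sequence of vectors is computable if each component sequence is. A real-valued function $f$ on $D\subset\mathbb{R}^m$ is Borel--Turing computable (also called Turing computable) if there is a Turing machine that transforms every representation of any computable $\mathbf{x}\in D$ into a representation of $f(\mathbf{x})$. It is Banach--Mazur computable if it maps every computable sequence of vectors in $D$ to a computable sequence of reals. A computable rectangle is a product of closed intervals with computable endpoints. A function $f$ on a computable rectangle is effectively uniformly continuous if there is a recursive function $d:\mathbb{N}\to\mathbb{N}$ such that for every $k$, with $n=d(k)$, $\|\mathbf{x}_1-\mathbf{x}_2\|\le 2^{-n}$ implies $|f(\mathbf{x}_1)-f(\mathbf{x}_2)|\le 2^{-k}$. A computable continuous function on a computable rectangle is a function that is both Banach--Mazur computable and effectively uniformly continuous. Assignment functions. For $f:\mathcal{R}_1\times\mathcal{R}_2\to\mathbb{R}$ and $x_2\in\mathcal{R}_2$ let $\mathcal{MIN}_1(x_2)=\{\widehat{x}_1\in\mathcal{R}_1: f(\widehat{x}_1,x_2)=\min_{y\in\mathcal{R}_1}f(y,x_2)\}$.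 An assignment function of $f$ for the first coordinate is a function $G_1:\mathcal{R}_2\to\mathcal{R}_1$ with $G_1(x_2)\in\mathcal{MIN}_1(x_2)$ for all $x_2\in\mathcal{R}_2$. The set of all such functions is $\mathcal{A}_1(f)$. *)

theory Defs
  imports "HOL-Analysis.Analysis" "HOL-Library.Stream"
begin

text \<open>
  Deterministic Turing machines with finitely many two-way infinite tapes. States and symbols are
  initial segments of the natural numbers; the start state is 0, symbol 0 is the blank and
  symbol 1 is the stroke used for unary numerals.
  A tape is recorded relative to its head: \<open>t i\<close> is the symbol in the cell \<open>i\<close> places to the right
  of the scanned one, so moving the head shifts the function.
\<close>

type_synonym tape = "int \<Rightarrow> nat"

datatype move = Move_Left | Stay | Move_Right

fun move_tape :: "move \<Rightarrow> tape \<Rightarrow> tape" where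
  "move_tape Move_Left t = (\<lambda>i. t (i - 1))"
| "move_tape Stay t = t"
| "move_tape Move_Right t = (\<lambda>i. t (i + 1))"

record tm =
  tm_tapes :: nat
  tm_states :: nat
  tm_symbols :: nat
  tm_final :: nat
  tm_delta :: "nat \<Rightarrow> nat list \<Rightarrow> nat \<times> (nat \<times> move) list"

definition tm_wf :: "tm \<Rightarrow> bool" where
  "tm_wf M \<longleftrightarrow> 0 < tm_states M \<and> tm_final M < tm_states M \<and> 2 \<le> tm_symbols M \<and>
    (\<forall>q rs q' acts. q < tm_states M \<longrightarrow> length rs = tm_tapes M \<longrightarrow> set rs \<subseteq> {..<tm_symbols M} \<longrightarrow>
       tm_delta M q rs = (q', acts) \<longrightarrow>
       q' < tm_states M \<and> length acts = tm_tapes M \<and> fst ` set acts \<subseteq> {..<tm_symbols M})"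

fun tm_step :: "tm \<Rightarrow> nat \<times> tape list \<Rightarrow> nat \<times> tape list" where
  "tm_step M (q, ts) =
     (if q = tm_final M then (q, ts)
      else let (q', acts) = tm_delta M q (map (\<lambda>t. t 0) ts)
           in (q', map2 (\<lambda>t (s, d). move_tape d (t(0 := s))) ts acts))"

definition blank_tape :: tape where
  "blank_tape = (\<lambda>i. 0)"

definition nat_tape :: "nat \<Rightarrow> tape" where
  "nat_tape n = (\<lambda>i. if 0 \<le> i \<and> i < int n then 1 else 0)"

text \<open>The number read off an output tape is the length of the block of strokes starting at the head.\<close>

definition tape_value :: "tape \<Rightarrow> nat" where
  "tape_value t = (LEAST n. t (int n) \<noteq> 1)"

text \<open>
  Started with \<open>ins\<close> on its first tapes and all other tapes blank, \<open>M\<close> halts with the numbers \<open>outs\<close>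
  on its first tapes. The input is a list of tapes rather than of numbers because machines
  transforming infinite sequences have an infinite inscription on some input tapes.
\<close>

definition tm_yields :: "tm \<Rightarrow> tape list \<Rightarrow> nat list \<Rightarrow> bool" where
  "tm_yields M ins outs \<longleftrightarrow>
     length ins \<le> tm_tapes M \<and> length outs \<le> tm_tapes M \<and>
     (\<exists>n ts. (tm_step M ^^ n) (0, ins @ replicate (tm_tapes M - length ins) blank_tape)
               = (tm_final M, ts) \<and>
             map tape_value (take (length outs) ts) = outs)"

text \<open>
  A rational number is output as any triple \<open>s, p, q\<close> with value \<open>(-1)^s p / q\<close> and \<open>q \<noteq> 0\<close>,
  not necessarily in lowest terms.
\<close>

definition tm_yields_rat :: "tm \<Rightarrow> tape list \<Rightarrow> rat \<Rightarrow> bool" where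
  "tm_yields_rat M ins r \<longleftrightarrow>
     (\<exists>s p q. tm_yields M ins [s, p, q] \<and> q \<noteq> 0 \<and> r = (- 1) ^ s * of_nat p / of_nat q)"

text \<open>
  The infinite inscription presenting a sequence of rationals as input: for each entry, in order,
  the three numbers sign, numerator, denominator (in lowest terms), each written as a block of
  strokes followed by a blank; the head is initially on the leftmost cell.
\<close>

definition rat_word :: "rat \<Rightarrow> nat list" where
  "rat_word r = (case quotient_of r of (p, q) \<Rightarrow>
     concat (map (\<lambda>n. replicate n 1 @ [0]) [if p < 0 then 1 else 0, nat \<bar>p\<bar>, nat q]))"

definition seq_tape :: "(nat \<Rightarrow> rat) \<Rightarrow> tape" where
  "seq_tape r = (\<lambda>i. if 0 \<le> i then flat (smap (\<lambda>k. rat_word (r k)) nats) !! nat i else 0)"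

definition recursive_function :: "(nat \<Rightarrow> nat) \<Rightarrow> bool" where
  "recursive_function d \<longleftrightarrow> (\<exists>M. tm_wf M \<and> (\<forall>n. tm_yields M [nat_tape n] [d n]))"

definition computable_rat_seq :: "(nat \<Rightarrow> rat) \<Rightarrow> bool" where
  "computable_rat_seq r \<longleftrightarrow> (\<exists>M. tm_wf M \<and> (\<forall>k. tm_yields_rat M [nat_tape k] (r k)))"

definition computable_rat_dseq :: "(nat \<Rightarrow> nat \<Rightarrow> rat) \<Rightarrow> bool" where
  "computable_rat_dseq r \<longleftrightarrow>
     (\<exists>M. tm_wf M \<and> (\<forall>n k. tm_yields_rat M [nat_tape n, nat_tape k] (r n k)))"

definition representation :: "(nat \<Rightarrow> rat) \<Rightarrow> real \<Rightarrow> bool" where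
  "representation r x \<longleftrightarrow> computable_rat_seq r \<and> (\<forall>k. \<bar>x - of_rat (r k)\<bar> \<le> 1 / 2 ^ k)"

definition computable_real :: "real \<Rightarrow> bool" where
  "computable_real x \<longleftrightarrow> (\<exists>r. representation r x)"

definition computable_real_seq :: "(nat \<Rightarrow> real) \<Rightarrow> bool" where
  "computable_real_seq x \<longleftrightarrow>
     (\<exists>r. computable_rat_dseq r \<and> (\<forall>n k. \<bar>x n - of_rat (r n k)\<bar> < 1 / 2 ^ k))"

text \<open>
  The components of a vector in a Euclidean space are its inner products with the standard basis
  vectors; for the type \<^typ>\<open>real\<close> itself the only basis vector is 1.
\<close>

definition computable_vec :: "'a::euclidean_space \<Rightarrow> bool" where
  "computable_vec x \<longleftrightarrow> (\<forall>i\<in>Basis. computable_real (x \<bullet> i))"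

definition vec_representation :: "('a::euclidean_space \<Rightarrow> nat \<Rightarrow> rat) \<Rightarrow> 'a \<Rightarrow> bool" where
  "vec_representation r x \<longleftrightarrow> (\<forall>i\<in>Basis. representation (r i) (x \<bullet> i))"

definition computable_vec_seq :: "(nat \<Rightarrow> 'a::euclidean_space) \<Rightarrow> bool" where
  "computable_vec_seq x \<longleftrightarrow> (\<forall>i\<in>Basis. computable_real_seq (\<lambda>n. x n \<bullet> i))"

text \<open>
  The machine transforms sequences of rationals: it has the representations of the components of
  \<open>x\<close> (in a fixed order \<open>bs\<close> of the coordinates) on its first tapes and the index \<open>k\<close> on the
  next one, and must produce entry \<open>k\<close> of a representation of \<open>f x\<close>.
\<close>

definition turing_computable_on :: "'a::euclidean_space set \<Rightarrow> ('a \<Rightarrow> real) \<Rightarrow> bool" where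
  "turing_computable_on D f \<longleftrightarrow>
     (\<exists>M bs. tm_wf M \<and> distinct bs \<and> set bs = Basis \<and>
        (\<forall>x\<in>D. computable_vec x \<longrightarrow>
          (\<forall>r. vec_representation r x \<longrightarrow>
            (\<exists>s. representation s (f x) \<and>
              (\<forall>k. tm_yields_rat M (map (\<lambda>i. seq_tape (r i)) bs @ [nat_tape k]) (s k))))))"

definition banach_mazur_computable_on :: "'a::euclidean_space set \<Rightarrow> ('a \<Rightarrow> real) \<Rightarrow> bool" where
  "banach_mazur_computable_on D f \<longleftrightarrow>
     (\<forall>x. computable_vec_seq x \<longrightarrow> (\<forall>n. x n \<in> D) \<longrightarrow> computable_real_seq (\<lambda>n. f (x n)))"

definition computable_rectangle :: "'a::euclidean_space set \<Rightarrow> bool" where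
  "computable_rectangle S \<longleftrightarrow>
     (\<exists>l u. computable_vec l \<and> computable_vec u \<and> (\<forall>i\<in>Basis. l \<bullet> i \<le> u \<bullet> i) \<and> S = cbox l u)"

definition effectively_uniformly_continuous_on ::
  "'a::euclidean_space set \<Rightarrow> ('a \<Rightarrow> real) \<Rightarrow> bool" where
  "effectively_uniformly_continuous_on S f \<longleftrightarrow>
     (\<exists>d. recursive_function d \<and>
       (\<forall>k. \<forall>x\<in>S. \<forall>y\<in>S. norm (x - y) \<le> 1 / 2 ^ d k \<longrightarrow> \<bar>f x - f y\<bar> \<le> 1 / 2 ^ k))"

definition computable_continuous_on :: "'a::euclidean_space set \<Rightarrow> ('a \<Rightarrow> real) \<Rightarrow> bool" where
  "computable_continuous_on S f \<longleftrightarrow>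
     computable_rectangle S \<and> banach_mazur_computable_on S f \<and>
     effectively_uniformly_continuous_on S f"

text \<open>Neighbouring pieces have different slopes, so \<open>n\<close> is the exact number of linear pieces.\<close>

definition piecewise_linear_on :: "real \<Rightarrow> real \<Rightarrow> nat \<Rightarrow> (real \<Rightarrow> real) \<Rightarrow> bool" where
  "piecewise_linear_on l u n f \<longleftrightarrow>
     (\<exists>t m c :: nat \<Rightarrow> real. t 0 = l \<and> t n = u \<and> (\<forall>i<n. t i < t (Suc i)) \<and>
        (\<forall>i<n. \<forall>x\<in>{t i..t (Suc i)}. f x = m i * x + c i) \<and>
        (\<forall>i. Suc i < n \<longrightarrow> m i \<noteq> m (Suc i)))"

definition global_minimizers :: "'a set \<Rightarrow> ('a \<Rightarrow> real) \<Rightarrow> 'a set" where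
  "global_minimizers S f = {x. is_arg_min f (\<lambda>y. y \<in> S) x}"

definition local_minimizers :: "'a::metric_space set \<Rightarrow> ('a \<Rightarrow> real) \<Rightarrow> 'a set" where
  "local_minimizers S f = {x. \<exists>e>0. is_arg_min f (\<lambda>y. y \<in> S \<inter> ball x e) x}"

text \<open>Only the values on \<open>R2\<close> of an element of \<open>assignment_functions1 R1 R2 f\<close> are constrained.\<close>

definition assignment_functions1 ::
  "real set \<Rightarrow> real set \<Rightarrow> (real \<times> real \<Rightarrow> real) \<Rightarrow> (real \<Rightarrow> real) set" where
  "assignment_functions1 R1 R2 f =
     {G. \<forall>x2\<in>R2. G x2 \<in> global_minimizers R1 (\<lambda>x1. f (x1, x2))}"

end

theory Submission
  imports Defs
begin

text \<open>
  Take \<open>f(x, y) = max 0 (|x| - 1) + |y| - x y / N\<close> with a natural number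
  \<open>N\<close> at least \<open>a + 1\<close> and \<open>b + 1\<close>. For fixed
  \<open>y\<close> it is a trough with flat bottom \<open>[-1, 1]\<close> that has been tilted
  by the slope \<open>- y / N\<close>. The walls have slopes \<open>\<plusminus>1\<close> before
  the tilt and \<open>|y / N| < 1\<close>, so for \<open>y \<noteq> 0\<close> the only minimizer
  is the lower end of the bottom, which is \<open>sgn y\<close>. For fixed \<open>x\<close> the
  function is \<open>|y|\<close> plus an affine function of slope less than 1 in absolute value,
  so it decreases strictly towards \<open>y = 0\<close>. Hence all local minimizers lie on
  \<open>y = 0\<close>, where the untilted trough leaves exactly the convex set
  \<open>[-1, 1] \<times> {0}\<close>.

  Every assignment function jumps from \<open>-1\<close> to \<open>1\<close> at 0. No machine
  can compute such a jump, and no undecidability result is involved: a halting run inspects only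
  finitely many cells, so the answer given for the representation \<open>0, 0, 0, ...\<close> of
  0 is also given for every representation that agrees with it on sufficiently many entries.
  Both \<open>1 / 2 ^ j\<close> and \<open>- 1 / 2 ^ j\<close> have such representations for
  large \<open>j\<close>, so one rational number would have to approximate both \<open>1\<close>
  and \<open>-1\<close> (lemmas \<open>tm_yields_use\<close>,
  \<open>turing_computable_at_zero\<close>, \<open>sign_jump_not_turing_computable\<close>).

  Computability of \<open>f\<close> requires machines. Given machines that produce rational
  approximations of \<open>x n\<close> and \<open>y n\<close>, one has to build a machine that
  runs both on a common index and performs rational arithmetic on the results. Three
  observations keep the construction small. A tape holding a unary number is a counter: a step
  to the left that writes a stroke increments it and a step to the right that erases one
  decrements it. So a language of bounded loops over registers compiles directly to machines
  (\<open>compile_correct\<close>), and arithmetic becomes loop programming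
  (\<open>tm_computable_loop\<close>). A foreign machine is used only once, so it can be given
  its own block of fresh tapes and nothing has to be cleaned up after it
  (\<open>halts_with_lift\<close>). And since the inputs of a function come first on the tapes,
  lifting a machine by some tapes carries extra arguments along, and together with composition
  this lets machines be chained freely (\<open>tm_computable_frame\<close>,
  \<open>tm_computable_compose\<close>). As \<open>f\<close> is Lipschitz on the rectangle,
  evaluating it at approximations of accuracy \<open>1 / 2 ^ (k + 2)\<close> gives accuracy
  \<open>1 / 2 ^ k\<close>.
\<close>


section \<open>Runs of machines and machine combinators\<close>

definition reaches :: "tm \<Rightarrow> nat \<times> tape list \<Rightarrow> nat \<times> tape list \<Rightarrow> bool" where
  "reaches M c c' \<longleftrightarrow> (\<exists>n. (tm_step M ^^ n) c = c')"

lemma reaches_refl: "reaches M c c"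
  unfolding reaches_def by (rule exI[of _ 0]) simp

lemma reaches_step: "reaches M c (tm_step M c)"
  unfolding reaches_def by (rule exI[of _ 1]) simp

lemma reaches_trans: "reaches M c c' \<Longrightarrow> reaches M c' c'' \<Longrightarrow> reaches M c c''"
  unfolding reaches_def by (metis comp_apply funpow_add)

text \<open>
  Machine well-formedness says nothing about symbols outside the alphabet, so runs are only
  controlled on tapes that stay inside it. Combinators below require all parts to share the
  number \<open>K\<close> of tapes and the alphabet size \<open>g\<close>.
\<close>

definition tapes_over :: "nat \<Rightarrow> nat \<Rightarrow> tape list \<Rightarrow> bool" where
  "tapes_over K g ts \<longleftrightarrow> length ts = K \<and> (\<forall>t\<in>set ts. \<forall>i. t i < g)"

definition tm_over :: "nat \<Rightarrow> nat \<Rightarrow> tm \<Rightarrow> bool" where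
  "tm_over K g M \<longleftrightarrow> tm_wf M \<and> tm_tapes M = K \<and> tm_symbols M = g"

lemma tm_overD:
  assumes "tm_over K g M"
  shows "tm_wf M" "tm_tapes M = K" "tm_symbols M = g" "0 < tm_states M"
    "tm_final M < tm_states M" "2 \<le> g"
  using assms by (simp_all add: tm_over_def) (auto simp: tm_wf_def)

lemma tm_over_delta:
  assumes "tm_over K g M" "q < tm_states M" "length rs = K" "set rs \<subseteq> {..<g}"
    "tm_delta M q rs = (q', acts)"
  shows "q' < tm_states M" "length acts = K" "fst ` set acts \<subseteq> {..<g}"
  using assms unfolding tm_over_def tm_wf_def by metis+

lemma tm_overI:
  assumes "0 < tm_states M" "tm_final M < tm_states M" "2 \<le> g" "tm_tapes M = K" "tm_symbols M = g"
    and "\<And>q rs. q < tm_states M \<Longrightarrow> length rs = K \<Longrightarrow> set rs \<subseteq> {..<g} \<Longrightarrow>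
       fst (tm_delta M q rs) < tm_states M \<and> length (snd (tm_delta M q rs)) = K \<and>
       fst ` set (snd (tm_delta M q rs)) \<subseteq> {..<g}"
  shows "tm_over K g M"
  unfolding tm_over_def tm_wf_def
proof (intro conjI allI impI)
  fix q rs q' acts
  assume "q < tm_states M" "length rs = tm_tapes M" "set rs \<subseteq> {..<tm_symbols M}"
    "tm_delta M q rs = (q', acts)"
  then show "q' < tm_states M" "length acts = tm_tapes M" "fst ` set acts \<subseteq> {..<tm_symbols M}"
    using assms(6)[of q rs] assms(4,5) by simp_all
qed (use assms in simp_all)

abbreviation perform :: "tape list \<Rightarrow> (nat \<times> move) list \<Rightarrow> tape list" where
  "perform ts acts \<equiv> map2 (\<lambda>t (s, d). move_tape d (t(0 := s))) ts acts"

abbreviation heads :: "tape list \<Rightarrow> nat list" where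
  "heads ts \<equiv> map (\<lambda>t. t 0) ts"

lemma move_tape_less: "(\<And>i. t i < g) \<Longrightarrow> s < g \<Longrightarrow> move_tape d (t(0 := s)) i < (g::nat)"
  by (cases d) auto

lemma tapes_over_step:
  assumes "tm_over K g M" "q < tm_states M" "tapes_over K g ts"
  shows "fst (tm_step M (q, ts)) < tm_states M \<and> tapes_over K g (snd (tm_step M (q, ts)))"
proof (cases "q = tm_final M")
  case True
  then show ?thesis using assms by simp
next
  case False
  obtain q' acts where d: "tm_delta M q (heads ts) = (q', acts)" by fastforce
  have h: "length (heads ts) = K" "set (heads ts) \<subseteq> {..<g}"
    using assms(3) by (auto simp: tapes_over_def)
  note * = tm_over_delta[OF assms(1,2) h d]
  have "\<forall>t\<in>set (perform ts acts). \<forall>i. t i < g"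
  proof (intro ballI allI)
    fix t i assume "t \<in> set (perform ts acts)"
    then obtain u s m where "(u, (s, m)) \<in> set (zip ts acts)" and t: "t = move_tape m (u(0 := s))"
      by auto
    then have "u \<in> set ts" "s < g"
      using *(3) by (meson set_zip_leftD, metis fst_conv imageI lessThan_iff set_zip_rightD subsetD)
    then show "t i < g"
      using assms(3) unfolding t tapes_over_def by (intro move_tape_less) auto
  qed
  then show ?thesis
    using False d * assms(3) by (auto simp: tapes_over_def)
qed

lemma tapes_over_reaches:
  assumes "tm_over K g M" "reaches M (q, ts) (q', ts')" "q < tm_states M" "tapes_over K g ts"
  shows "tapes_over K g ts'"
proof -
  obtain n where n: "(tm_step M ^^ n) (q, ts) = (q', ts')"
    using assms(2) by (auto simp: reaches_def)
  have "fst ((tm_step M ^^ n) (q, ts)) < tm_states M \<and> tapes_over K g (snd ((tm_step M ^^ n) (q, ts)))"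
  proof (induction n)
    case (Suc n)
    then show ?case
      using tapes_over_step[OF assms(1)] by (cases "(tm_step M ^^ n) (q, ts)") simp
  qed (use assms in simp)
  then show ?thesis using n by simp
qed

text \<open>
  One simulation argument serves all combinators: if \<open>B\<close> copies, along the coding
  \<open>h\<close> of configurations, every step of \<open>A\<close> taken outside the final
  state, then it copies every run. The final state is exempt because a combined machine
  continues there with its next part.
\<close>

lemma reaches_simulation:
  assumes A: "tm_over K g A"
    and sim: "\<And>q ts. q < tm_states A \<Longrightarrow> tapes_over K g ts \<Longrightarrow> q \<noteq> tm_final A \<Longrightarrow>
      tm_step B (h (q, ts)) = h (tm_step A (q, ts))"
    and "reaches A (q, ts) c'" "q < tm_states A" "tapes_over K g ts"
  shows "reaches B (h (q, ts)) (h c')"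
proof -
  obtain n where "(tm_step A ^^ n) (q, ts) = c'"
    using assms(3) by (auto simp: reaches_def)
  then show ?thesis using assms(4,5)
  proof (induction n arbitrary: q ts)
    case 0
    then show ?case by (auto simp: reaches_refl)
  next
    case (Suc n)
    show ?case
    proof (cases "q = tm_final A")
      case True
      then have "tm_step A (q, ts) = (q, ts)" by simp
      then show ?thesis using Suc by (metis funpow_simps_right(2) o_apply)
    next
      case False
      obtain q1 ts1 where s: "tm_step A (q, ts) = (q1, ts1)" by fastforce
      have "q1 < tm_states A" "tapes_over K g ts1"
        using tapes_over_step[OF A Suc.prems(2,3)] s by auto
      moreover have "(tm_step A ^^ n) (q1, ts1) = c'"
        using Suc.prems(1) s by (metis funpow_simps_right(2) o_apply)
      ultimately have "reaches B (h (q1, ts1)) (h c')" by (intro Suc.IH)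
      then show ?thesis
        using reaches_trans[OF reaches_step] sim[OF Suc.prems(2,3) False] s by metis
    qed
  qed
qed

definition halts_with :: "tm \<Rightarrow> tape list \<Rightarrow> tape list \<Rightarrow> bool" where
  "halts_with M ts ts' \<longleftrightarrow> reaches M (0, ts) (tm_final M, ts')"

lemma halts_with_tapes_over:
  "tm_over K g M \<Longrightarrow> halts_with M ts ts' \<Longrightarrow> tapes_over K g ts \<Longrightarrow> tapes_over K g ts'"
  unfolding halts_with_def by (rule tapes_over_reaches) (auto dest: tm_overD)

abbreviation idle :: "nat list \<Rightarrow> (nat \<times> move) list" where
  "idle rs \<equiv> map (\<lambda>s. (s, Stay)) rs"

lemma perform_idle: "perform ts (map ((\<lambda>s. (s, Stay)) \<circ> (\<lambda>t. t 0)) ts) = ts"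
  by (induction ts) auto

lemma fst_idle: "fst ` set (idle rs) = set rs"
  by force

definition tm_seq :: "tm \<Rightarrow> tm \<Rightarrow> tm" where
  "tm_seq A B = \<lparr>tm_tapes = tm_tapes A, tm_states = tm_states A + tm_states B,
     tm_symbols = tm_symbols A, tm_final = tm_states A + tm_final B,
     tm_delta = (\<lambda>q rs.
       if q = tm_final A then (tm_states A, idle rs)
       else if q < tm_states A then tm_delta A q rs
       else apfst (\<lambda>q'. tm_states A + q') (tm_delta B (q - tm_states A) rs))\<rparr>"

lemma tm_over_seq:
  assumes "tm_over K g A" "tm_over K g B"
  shows "tm_over K g (tm_seq A B)"
proof (rule tm_overI)
  fix q rs assume *: "q < tm_states (tm_seq A B)" "length rs = K" "set rs \<subseteq> {..<g}"
  show "fst (tm_delta (tm_seq A B) q rs) < tm_states (tm_seq A B) \<and>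
    length (snd (tm_delta (tm_seq A B) q rs)) = K \<and>
    fst ` set (snd (tm_delta (tm_seq A B) q rs)) \<subseteq> {..<g}"
  proof (cases "q < tm_states A")
    case True
    then show ?thesis
      using * tm_over_delta[OF assms(1) True *(2,3)] tm_overD[OF assms(2)]
      by (cases "tm_delta A q rs") (auto simp: tm_seq_def fst_idle)
  next
    case False
    then have "q - tm_states A < tm_states B" using *(1) by (simp add: tm_seq_def)
    note tm_over_delta[OF assms(2) this *(2,3)]
    then show ?thesis
      using False tm_overD[OF assms(1)]
      by (cases "tm_delta B (q - tm_states A) rs") (auto simp: tm_seq_def)
  qed
qed (use tm_overD[OF assms(1)] tm_overD[OF assms(2)] in \<open>auto simp: tm_seq_def\<close>)

lemma halts_with_seq:
  assumes A: "tm_over K g A" and B: "tm_over K g B" and ts: "tapes_over K g ts"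
    and "halts_with A ts ts'" "halts_with B ts' ts''"
  shows "halts_with (tm_seq A B) ts ts''"
proof -
  note D = tm_overD[OF A] tm_overD[OF B]
  have "reaches (tm_seq A B) (id (0, ts)) (id (tm_final A, ts'))"
    by (rule reaches_simulation[OF A _ _ _ ts])
      (use D assms(4) in \<open>auto simp: halts_with_def tm_seq_def\<close>)
  moreover have "tm_step (tm_seq A B) (tm_final A, ts') = (tm_states A, ts')"
    using D by (simp add: tm_seq_def perform_idle)
  moreover have "reaches (tm_seq A B) (apfst (\<lambda>q. tm_states A + q) (0, ts'))
      (apfst (\<lambda>q. tm_states A + q) (tm_final B, ts''))"
    by (rule reaches_simulation[OF B _ _ _ halts_with_tapes_over[OF A assms(4) ts]])
      (use D assms(5) in \<open>auto simp: halts_with_def tm_seq_def split: prod.splits\<close>)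
  moreover have "tm_final (tm_seq A B) = tm_states A + tm_final B" by (simp add: tm_seq_def)
  ultimately show ?thesis
    unfolding halts_with_def using reaches_step[of "tm_seq A B" "(tm_final A, ts')"]
    by (auto intro: reaches_trans)
qed

text \<open>
  State 0 tests whether tape \<open>i\<close> shows a stroke, state 1 is final, and the states
  of the body are shifted by 2. The value given to state 1 only has to respect well-formedness,
  as a final state is never left.
\<close>

definition tm_while :: "nat \<Rightarrow> tm \<Rightarrow> tm" where
  "tm_while i A = \<lparr>tm_tapes = tm_tapes A, tm_states = 2 + tm_states A,
     tm_symbols = tm_symbols A, tm_final = 1,
     tm_delta = (\<lambda>q rs.
       if q = 0 then (if rs ! i = 1 then 2 else 1, idle rs)
       else if q = 1 \<or> q = 2 + tm_final A then (0, idle rs)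
       else apfst (\<lambda>q'. 2 + q') (tm_delta A (q - 2) rs))\<rparr>"

lemma tm_over_while:
  assumes "tm_over K g A"
  shows "tm_over K g (tm_while i A)"
proof (rule tm_overI)
  fix q rs assume *: "q < tm_states (tm_while i A)" "length rs = K" "set rs \<subseteq> {..<g}"
  show "fst (tm_delta (tm_while i A) q rs) < tm_states (tm_while i A) \<and>
    length (snd (tm_delta (tm_while i A) q rs)) = K \<and>
    fst ` set (snd (tm_delta (tm_while i A) q rs)) \<subseteq> {..<g}"
  proof (cases "q < 2")
    case True
    then show ?thesis
      using * tm_overD[OF assms] by (auto simp: tm_while_def fst_idle)
  next
    case False
    then have "q - 2 < tm_states A" using *(1) by (simp add: tm_while_def)
    note tm_over_delta[OF assms this *(2,3)]
    then show ?thesis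
      using False tm_overD[OF assms] *(2,3)
      by (cases "tm_delta A (q - 2) rs") (auto simp: tm_while_def fst_idle)
  qed
qed (use tm_overD[OF assms] in \<open>auto simp: tm_while_def\<close>)

lemma halts_with_while_done:
  assumes "i < length ts" "(ts ! i) 0 \<noteq> 1"
  shows "halts_with (tm_while i A) ts ts"
proof -
  have "tm_step (tm_while i A) (0, ts) = (1, ts)"
    using assms by (simp add: tm_while_def perform_idle)
  then show ?thesis
    unfolding halts_with_def using reaches_step[of "tm_while i A" "(0, ts)"]
    by (simp add: tm_while_def)
qed

lemma halts_with_while_iterate:
  assumes A: "tm_over K g A" and ts: "tapes_over K g ts" and "i < K" "(ts ! i) 0 = 1"
    and "halts_with A ts ts'" "halts_with (tm_while i A) ts' ts''"
  shows "halts_with (tm_while i A) ts ts''"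
proof -
  note D = tm_overD[OF A]
  have "tm_step (tm_while i A) (0, ts) = (2, ts)"
    using assms by (simp add: tm_while_def perform_idle tapes_over_def)
  moreover have "reaches (tm_while i A) (apfst (\<lambda>q. 2 + q) (0, ts)) (apfst (\<lambda>q. 2 + q) (tm_final A, ts'))"
    by (rule reaches_simulation[OF A _ _ _ ts])
      (use D assms(5) in \<open>auto simp: halts_with_def tm_while_def split: prod.splits\<close>)
  moreover have "tm_step (tm_while i A) (2 + tm_final A, ts') = (0, ts')"
    by (simp add: tm_while_def perform_idle)
  ultimately have "reaches (tm_while i A) (0, ts) (0, ts')"
    unfolding apfst_conv add_0_right by (metis reaches_step reaches_trans)
  then show ?thesis
    using assms(6) unfolding halts_with_def by (rule reaches_trans)
qed

definition tm_act :: "nat \<Rightarrow> nat \<Rightarrow> nat \<Rightarrow> (nat \<Rightarrow> nat \<times> move) \<Rightarrow> tm" where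
  "tm_act K g i \<phi> = \<lparr>tm_tapes = K, tm_states = 2, tm_symbols = g, tm_final = 1,
     tm_delta = (\<lambda>q rs. (1, (idle rs)[i := \<phi> (rs ! i)]))\<rparr>"

lemma tm_over_act:
  assumes "2 \<le> g" "i < K" "\<And>s. s < g \<Longrightarrow> fst (\<phi> s) < g"
  shows "tm_over K g (tm_act K g i \<phi>)"
proof (rule tm_overI)
  fix q rs assume *: "length rs = K" "set rs \<subseteq> {..<g}"
  have "rs ! i \<in> {..<g}" using * assms(2) nth_mem by blast
  then have "fst (\<phi> (rs ! i)) < g" using assms(3) by simp
  then have "insert (fst (\<phi> (rs ! i))) (set rs) \<subseteq> {..<g}" using *(2) by simp
  moreover have "fst ` set ((idle rs)[i := \<phi> (rs ! i)]) \<subseteq> insert (fst (\<phi> (rs ! i))) (set rs)"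
    using image_mono[OF set_update_subset_insert[of "idle rs" i "\<phi> (rs ! i)"], of fst]
    unfolding image_insert fst_idle .
  ultimately have "fst ` set ((idle rs)[i := \<phi> (rs ! i)]) \<subseteq> {..<g}" by (rule order_trans[rotated])
  then show "fst (tm_delta (tm_act K g i \<phi>) q rs) < tm_states (tm_act K g i \<phi>) \<and>
    length (snd (tm_delta (tm_act K g i \<phi>) q rs)) = K \<and>
    fst ` set (snd (tm_delta (tm_act K g i \<phi>) q rs)) \<subseteq> {..<g}"
    using *(1) unfolding tm_act_def by simp
qed (use assms in \<open>auto simp: tm_act_def\<close>)

lemma halts_with_act:
  assumes "i < length ts" and phi: "\<phi> ((ts ! i) 0) = (s, m)"
  shows "halts_with (tm_act K g i \<phi>) ts (ts[i := move_tape m ((ts ! i)(0 := s))])"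
proof -
  have "perform ts ((idle (heads ts))[i := (s, m)]) = ts[i := move_tape m ((ts ! i)(0 := s))]"
    by (rule nth_equalityI) (use assms in \<open>auto simp: nth_list_update\<close>)
  then have "tm_step (tm_act K g i \<phi>) (0, ts) = (1, ts[i := move_tape m ((ts ! i)(0 := s))])"
    using assms by (simp add: tm_act_def)
  then show ?thesis
    unfolding halts_with_def using reaches_step[of "tm_act K g i \<phi>" "(0, ts)"]
    by (simp add: tm_act_def)
qed

text \<open>
  The machine works on the block of tapes from \<open>j\<close> on. Outside its own alphabet its
  transition function may be ill-formed, so there it is replaced by idling; this case never
  occurs in a run that starts on admissible tapes.
\<close>

definition tm_lift :: "nat \<Rightarrow> nat \<Rightarrow> nat \<Rightarrow> tm \<Rightarrow> tm" where
  "tm_lift j K g A = A\<lparr>tm_tapes := K, tm_symbols := g,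
     tm_delta := (\<lambda>q rs. let us = take (tm_tapes A) (drop j rs) in
       if set us \<subseteq> {..<tm_symbols A}
       then apsnd (\<lambda>acts. idle (take j rs) @ acts @ idle (drop (j + tm_tapes A) rs)) (tm_delta A q us)
       else (q, idle rs))\<rparr>"

lemma tm_over_lift:
  assumes "tm_wf A" "j + tm_tapes A \<le> K" "tm_symbols A \<le> g"
  shows "tm_over K g (tm_lift j K g A)"
proof (rule tm_overI)
  have A: "tm_over (tm_tapes A) (tm_symbols A) A" using assms(1) by (simp add: tm_over_def)
  fix q rs assume *: "q < tm_states (tm_lift j K g A)" "length rs = K" "set rs \<subseteq> {..<g}"
  define us where "us = take (tm_tapes A) (drop j rs)"
  have us: "length us = tm_tapes A" using *(2) assms(2) by (simp add: us_def)
  have q: "q < tm_states A" using *(1) by (simp add: tm_lift_def)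
  show "fst (tm_delta (tm_lift j K g A) q rs) < tm_states (tm_lift j K g A) \<and>
    length (snd (tm_delta (tm_lift j K g A) q rs)) = K \<and>
    fst ` set (snd (tm_delta (tm_lift j K g A) q rs)) \<subseteq> {..<g}"
  proof (cases "set us \<subseteq> {..<tm_symbols A}")
    case True
    obtain q' acts where d: "tm_delta A q us = (q', acts)" by fastforce
    note D = tm_over_delta[OF A q us True d]
    have "fst ` set (idle (take j rs)) \<subseteq> {..<g}" "fst ` set (idle (drop (j + tm_tapes A) rs)) \<subseteq> {..<g}"
      unfolding fst_idle using *(3) by (auto dest: in_set_takeD in_set_dropD)
    then have "fst ` set (idle (take j rs) @ acts @ idle (drop (j + tm_tapes A) rs)) \<subseteq> {..<g}"
      using D(3) assms(3) unfolding set_append image_Un by fastforce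
    then show ?thesis
      using True D d * assms(2) by (simp add: tm_lift_def flip: us_def)
  next
    case False
    then show ?thesis
      using * q by (simp add: tm_lift_def flip: us_def) force
  qed
qed (use assms in \<open>auto simp: tm_lift_def tm_wf_def\<close>)

lemma halts_with_lift:
  assumes wf: "tm_wf A" and ts: "tapes_over (tm_tapes A) (tm_symbols A) ts"
    and "halts_with A ts ts'"
  shows "halts_with (tm_lift (length us) K g A) (us @ ts @ vs) (us @ ts' @ vs)"
proof -
  have A: "tm_over (tm_tapes A) (tm_symbols A) A" using wf by (simp add: tm_over_def)
  have "reaches (tm_lift (length us) K g A) (apsnd (\<lambda>ts. us @ ts @ vs) (0, ts))
      (apsnd (\<lambda>ts. us @ ts @ vs) (tm_final A, ts'))"
  proof (rule reaches_simulation[OF A _ _ _ ts])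
    fix q ts assume q: "q < tm_states A" "tapes_over (tm_tapes A) (tm_symbols A) ts" "q \<noteq> tm_final A"
    obtain q' acts where d: "tm_delta A q (heads ts) = (q', acts)" by fastforce
    have h: "set (heads ts) \<subseteq> {..<tm_symbols A}" "length ts = tm_tapes A"
      using q(2) by (auto simp: tapes_over_def)
    then have "length acts = tm_tapes A" using tm_over_delta[OF A q(1) _ h(1) d] by simp
    then have "perform (us @ ts @ vs) (idle (heads us) @ acts @ idle (heads vs)) =
        us @ perform ts acts @ vs"
      using h(2) by (simp add: perform_idle)
    then show "tm_step (tm_lift (length us) K g A) (apsnd (\<lambda>ts. us @ ts @ vs) (q, ts)) =
        apsnd (\<lambda>ts. us @ ts @ vs) (tm_step A (q, ts))"
      using q(3) h d by (simp add: tm_lift_def)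
  qed (use assms(3) tm_overD[OF A] in \<open>auto simp: halts_with_def\<close>)
  then show ?thesis
    by (simp add: halts_with_def tm_lift_def)
qed

section \<open>A language of bounded loops, run on unary counters\<close>

text \<open>
  The part of a tape relevant for \<open>tape_value\<close>, stated positively: the least number
  with a property is arbitrary where none has it, as on a tape with strokes only, and
  \<open>holds\<close> excludes that case.
\<close>

definition holds :: "tape \<Rightarrow> nat \<Rightarrow> bool" where
  "holds t v \<longleftrightarrow> (\<forall>j<v. t (int j) = 1) \<and> t (int v) \<noteq> 1"

lemma holds_tape_value: "holds t v \<Longrightarrow> tape_value t = v"
  unfolding holds_def tape_value_def by (rule Least_equality) (auto intro: leI)

lemma holds_nat_tape: "holds (nat_tape v) v"
  by (auto simp: holds_def nat_tape_def)

text \<open>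
  Guarantees that the block of strokes at the head is finite. It holds on unary numbers and on
  inscriptions of rational sequences alike, and it survives every step, because a step changes
  one cell and shifts the rest by at most one.
\<close>

definition unbounded_gaps :: "tape \<Rightarrow> bool" where
  "unbounded_gaps t \<longleftrightarrow> (\<forall>N. \<exists>i\<ge>N. t i \<noteq> 1)"

lemma unbounded_gaps_holds:
  assumes "unbounded_gaps t"
  shows "holds t (tape_value t)"
proof -
  obtain i where "i \<ge> 0" "t i \<noteq> 1"
    using assms unfolding unbounded_gaps_def by blast
  then have "t (int (nat i)) \<noteq> 1" by simp
  then have "t (int (LEAST n. t (int n) \<noteq> 1)) \<noteq> 1" by (rule LeastI)
  then show ?thesis
    unfolding holds_def tape_value_def using not_less_Least by blast
qed

lemma unbounded_gaps_move:
  assumes "unbounded_gaps t"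
  shows "unbounded_gaps (move_tape m (t(0 := s)))"
  unfolding unbounded_gaps_def
proof
  fix N
  obtain i where "i \<ge> \<bar>N\<bar> + 2" "t i \<noteq> 1"
    using assms unfolding unbounded_gaps_def by blast
  then show "\<exists>i\<ge>N. move_tape m (t(0 := s)) i \<noteq> 1"
    by (cases m) (auto intro!: exI[of _ "i + (case m of Move_Left \<Rightarrow> 1 | Stay \<Rightarrow> 0 | Move_Right \<Rightarrow> -1)"])
qed

lemma unbounded_gaps_nat_tape: "unbounded_gaps (nat_tape n)"
  unfolding unbounded_gaps_def nat_tape_def
proof
  fix N
  show "\<exists>i\<ge>N. (if 0 \<le> i \<and> i < int n then 1 else 0) \<noteq> (1::nat)"
    by (rule exI[of _ "max N (int n)"]) auto
qed

lemma unbounded_gaps_step: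
  "\<forall>t\<in>set ts. unbounded_gaps t \<Longrightarrow> \<forall>t\<in>set (snd (tm_step M (q, ts))). unbounded_gaps t"
  by (auto split: prod.splits intro!: unbounded_gaps_move dest!: set_zip_leftD)

lemma unbounded_gaps_steps:
  assumes "\<forall>t\<in>set ts. unbounded_gaps t"
  shows "\<forall>t\<in>set (snd ((tm_step M ^^ n) (q, ts))). unbounded_gaps t"
proof (induction n)
  case (Suc n)
  then show ?case
    using unbounded_gaps_step[of "snd ((tm_step M ^^ n) (q, ts))" M "fst ((tm_step M ^^ n) (q, ts))"]
    by simp
qed (use assms in simp)

lemma unbounded_gaps_halts_with:
  assumes "halts_with M ts ts'" "\<forall>t\<in>set ts. unbounded_gaps t"
  shows "\<forall>t\<in>set ts'. unbounded_gaps t"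
  using assms unbounded_gaps_steps[OF assms(2)] unfolding halts_with_def reaches_def by (metis snd_conv)

text \<open>
  Two ways of holding a number. An exact tape is blank apart from the number and can serve as
  input of another machine. An inexact tape, such as an output tape of an arbitrary machine, may
  contain anything beyond the first gap. Counting up and down works on both kinds and preserves
  the kind.
\<close>

definition represents :: "bool \<Rightarrow> tape \<Rightarrow> nat \<Rightarrow> bool" where
  "represents exact t v \<longleftrightarrow> (if exact then t = nat_tape v else holds t v)"

lemma represents_holds: "represents b t v \<Longrightarrow> holds t v"
  by (auto simp: represents_def holds_nat_tape split: if_splits)

lemma represents_head: "represents b t v \<Longrightarrow> t 0 = 1 \<longleftrightarrow> v \<noteq> 0"
  using represents_holds[of b t v] by (cases "v = 0") (auto simp: holds_def)

lemma represents_inc: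
  assumes "represents b t v"
  shows "represents b ((move_tape Move_Left (t(0 := t 0)))(0 := 1)) (Suc v)"
proof (cases b)
  case False
  then have t: "\<forall>j<v. t (int j) = 1" "t (int v) \<noteq> 1" using assms by (auto simp: represents_def holds_def)
  have "t (int j - 1) = 1" if "j < Suc v" "j \<noteq> 0" for j
    using t(1)[rule_format, of "j - 1"] that by (simp add: of_nat_diff)
  then show ?thesis using False t by (auto simp: represents_def holds_def)
qed (use assms in \<open>auto simp: represents_def nat_tape_def fun_eq_iff\<close>)

lemma represents_dec:
  assumes "represents b t (Suc v)"
  shows "represents b (move_tape Move_Right (t(0 := 0))) v"
proof (cases b)
  case False
  then have t: "\<forall>j<Suc v. t (int j) = 1" "t (int (Suc v)) \<noteq> 1"
    using assms by (auto simp: represents_def holds_def)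
  have "t (int j + 1) = 1" if "j < v" for j
    using t(1)[rule_format, of "Suc j"] that by (simp add: add.commute)
  then show ?thesis using False t by (auto simp: represents_def holds_def add.commute)
qed (use assms in \<open>auto simp: represents_def nat_tape_def fun_eq_iff\<close>)

text \<open>
  \<open>S\<close> is the set of tapes that are exact.
\<close>

definition registers :: "nat set \<Rightarrow> (nat \<Rightarrow> nat) \<Rightarrow> tape list \<Rightarrow> bool" where
  "registers S \<sigma> ts \<longleftrightarrow> (\<forall>i<length ts. represents (i \<in> S) (ts ! i) (\<sigma> i))"

lemma registers_update:
  assumes "registers S \<sigma> ts" "represents (i \<in> S) t v"
  shows "registers S (\<sigma>(i := v)) (ts[i := t])"
  using assms by (auto simp: registers_def nth_list_update)

text \<open>
  \<open>Loop i p\<close> runs \<open>p\<close> as often as the initial value of register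
  \<open>i\<close> says and leaves \<open>i\<close> empty. Bounded iteration makes the semantics
  a total function, so that programs can be verified by equational reasoning.
\<close>

datatype loop_prog = Skip | Inc nat | Dec nat | Seq loop_prog loop_prog | Loop nat loop_prog

fun regs :: "loop_prog \<Rightarrow> nat set" where
  "regs Skip = {}"
| "regs (Inc i) = {i}"
| "regs (Dec i) = {i}"
| "regs (Seq p q) = regs p \<union> regs q"
| "regs (Loop i p) = insert i (regs p)"

fun loop_wf :: "loop_prog \<Rightarrow> bool" where
  "loop_wf (Seq p q) \<longleftrightarrow> loop_wf p \<and> loop_wf q"
| "loop_wf (Loop i p) \<longleftrightarrow> loop_wf p \<and> i \<notin> regs p"
| "loop_wf _ \<longleftrightarrow> True"

fun run :: "loop_prog \<Rightarrow> (nat \<Rightarrow> nat) \<Rightarrow> nat \<Rightarrow> nat" where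
  "run Skip \<sigma> = \<sigma>"
| "run (Inc i) \<sigma> = \<sigma>(i := Suc (\<sigma> i))"
| "run (Dec i) \<sigma> = \<sigma>(i := \<sigma> i - 1)"
| "run (Seq p q) \<sigma> = run q (run p \<sigma>)"
| "run (Loop i p) \<sigma> = (run p ^^ \<sigma> i) (\<sigma>(i := 0))"

lemma finite_regs: "finite (regs p)"
  by (induction p) auto

text \<open>
  A program ignores the registers that it does not mention. For a loop this makes the counter
  invisible to the body: it may be counted down during the run, as a machine does it, or cleared
  in advance, as in \<open>run\<close>.
\<close>

lemma run_update_commute: "i \<notin> regs p \<Longrightarrow> run p (\<sigma>(i := v)) = (run p \<sigma>)(i := v)"
proof (induction p arbitrary: \<sigma>)
  case (Loop j p)
  have "(run p ^^ n) (\<sigma>(i := v)) = ((run p ^^ n) \<sigma>)(i := v)" for n \<sigma>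
    using Loop by (induction n) auto
  moreover have "\<sigma>(i := v, j := 0) = \<sigma>(j := 0, i := v)"
    using Loop.prems by auto
  moreover have "(\<sigma>(i := v)) j = \<sigma> j"
    using Loop.prems by auto
  ultimately show ?case
    by (simp only: run.simps)
qed (auto simp: fun_upd_twist)

lemma run_unused: "i \<notin> regs p \<Longrightarrow> run p \<sigma> i = \<sigma> i"
  using run_update_commute[of i p \<sigma> "\<sigma> i"] by (metis fun_upd_same fun_upd_triv)

fun compile :: "nat \<Rightarrow> nat \<Rightarrow> loop_prog \<Rightarrow> tm" where
  "compile K g Skip = tm_act K g 0 (\<lambda>s. (s, Stay))"
| "compile K g (Inc i) = tm_seq (tm_act K g i (\<lambda>s. (s, Move_Left))) (tm_act K g i (\<lambda>s. (1, Stay)))"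
| "compile K g (Dec i) = tm_act K g i (\<lambda>s. if s = 1 then (0, Move_Right) else (s, Stay))"
| "compile K g (Seq p q) = tm_seq (compile K g p) (compile K g q)"
| "compile K g (Loop i p) = tm_while i (tm_seq (compile K g (Dec i)) (compile K g p))"

lemma tm_over_compile:
  "regs p \<subseteq> {..<K} \<Longrightarrow> 2 \<le> g \<Longrightarrow> 0 < K \<Longrightarrow> tm_over K g (compile K g p)"
  by (induction p) (auto intro!: tm_over_seq tm_over_while tm_over_act)

text \<open>
  The decrement of a nonempty register, stated separately because it also opens each round of a
  compiled loop.
\<close>

lemma halts_with_Dec:
  assumes "i < length ts" "registers S \<sigma> ts" "\<sigma> i = Suc v"
  shows "\<exists>ts'. halts_with (compile K g (Dec i)) ts ts' \<and> registers S (\<sigma>(i := v)) ts'"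
proof -
  have r: "represents (i \<in> S) (ts ! i) (Suc v)" using assms by (auto simp: registers_def)
  then have "(ts ! i) 0 = 1" using represents_head[OF r] by simp
  then have "halts_with (compile K g (Dec i)) ts (ts[i := move_tape Move_Right ((ts ! i)(0 := 0))])"
    unfolding compile.simps by (intro halts_with_act) (use assms in auto)
  then show ?thesis using registers_update[OF assms(2) represents_dec[OF r]] by blast
qed

text \<open>
  The set \<open>S\<close> of exact tapes is arbitrary, so one verification covers programs that
  prepare inputs for other machines and programs that work on what other machines have left
  behind.
\<close>

lemma compile_correct:
  assumes "loop_wf p" "regs p \<subseteq> {..<K}" "2 \<le> g" "0 < K" "tapes_over K g ts" "registers S \<sigma> ts"
  shows "\<exists>ts'. halts_with (compile K g p) ts ts' \<and> registers S (run p \<sigma>) ts'"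
  using assms
proof (induction p arbitrary: ts \<sigma>)
  case Skip
  then have l: "0 < length ts" by (simp add: tapes_over_def)
  have "halts_with (compile K g Skip) ts (ts[0 := move_tape Stay ((ts ! 0)(0 := (ts ! 0) 0))])"
    unfolding compile.simps by (rule halts_with_act[OF l]) simp
  then show ?case using Skip by auto
next
  case (Inc i)
  then have l: "i < length ts" by (simp add: tapes_over_def)
  define ts1 where "ts1 = ts[i := move_tape Move_Left ((ts ! i)(0 := (ts ! i) 0))]"
  have "halts_with (tm_act K g i (\<lambda>s. (s, Move_Left))) ts ts1"
    unfolding ts1_def by (rule halts_with_act[OF l]) simp
  moreover have "halts_with (tm_act K g i (\<lambda>s. (1, Stay))) ts1
      (ts1[i := move_tape Stay ((ts1 ! i)(0 := 1))])"
    by (rule halts_with_act) (use l in \<open>auto simp: ts1_def\<close>)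
  ultimately have H: "halts_with (compile K g (Inc i)) ts (ts1[i := move_tape Stay ((ts1 ! i)(0 := 1))])"
    unfolding compile.simps using Inc.prems
    by (intro halts_with_seq[of K g]) (auto intro!: tm_over_act)
  have "represents (i \<in> S) ((move_tape Move_Left ((ts ! i)(0 := (ts ! i) 0)))(0 := 1)) (Suc (\<sigma> i))"
    by (rule represents_inc) (use Inc.prems l in \<open>auto simp: registers_def\<close>)
  then have "registers S (run (Inc i) \<sigma>) (ts1[i := move_tape Stay ((ts1 ! i)(0 := 1))])"
    using registers_update[OF Inc.prems(6), of i] l unfolding run.simps by (simp add: ts1_def)
  then show ?case using H by blast
next
  case (Dec i)
  then have l: "i < length ts" by (simp add: tapes_over_def)
  show ?case
  proof (cases "\<sigma> i")
    case 0
    have "represents (i \<in> S) (ts ! i) 0" using Dec.prems l 0 by (metis registers_def)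
    from represents_head[OF this] have "(ts ! i) 0 \<noteq> 1" by simp
    then have "halts_with (compile K g (Dec i)) ts (ts[i := move_tape Stay ((ts ! i)(0 := (ts ! i) 0))])"
      unfolding compile.simps by (intro halts_with_act[OF l]) simp
    then show ?thesis using Dec.prems 0 by (auto simp: fun_upd_idem)
  next
    case (Suc v)
    then show ?thesis
      using halts_with_Dec[OF l Dec.prems(6) Suc] by (simp only: run.simps diff_Suc_1)
  qed
next
  case (Seq p q)
  obtain ts1 where 1: "halts_with (compile K g p) ts ts1" "registers S (run p \<sigma>) ts1"
    using Seq.IH(1)[of ts \<sigma>] Seq.prems by auto
  have p: "tm_over K g (compile K g p)" and q: "tm_over K g (compile K g q)"
    using Seq.prems by (auto intro!: tm_over_compile)
  obtain ts2 where "halts_with (compile K g q) ts1 ts2" "registers S (run q (run p \<sigma>)) ts2"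
    using Seq.IH(2)[of ts1 "run p \<sigma>"] 1 Seq.prems halts_with_tapes_over[OF p] by auto
  then show ?case
    using halts_with_seq[OF p q] 1 Seq.prems by auto
next
  case (Loop i p)
  define B where "B = tm_seq (compile K g (Dec i)) (compile K g p)"
  have d: "tm_over K g (compile K g (Dec i))" and p: "tm_over K g (compile K g p)"
    using Loop.prems by (intro tm_over_compile; auto)+
  then have B: "tm_over K g B" unfolding B_def by (rule tm_over_seq)
  have "\<exists>ts'. halts_with (tm_while i B) ts ts' \<and> registers S ((run p ^^ c) (\<sigma>(i := 0))) ts'"
    if "\<sigma> i = c" "tapes_over K g ts" "registers S \<sigma> ts" for c \<sigma> ts
    using that
  proof (induction c arbitrary: \<sigma> ts)
    case 0
    have l: "i < length ts" using 0 Loop.prems by (simp add: tapes_over_def)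
    then have "represents (i \<in> S) (ts ! i) 0" using 0 by (metis registers_def)
    from represents_head[OF this] have "halts_with (tm_while i B) ts ts"
      using l by (intro halts_with_while_done) auto
    then show ?case using 0 by (auto simp: fun_upd_idem)
  next
    case (Suc c)
    have l: "i < length ts" using Suc.prems Loop.prems by (simp add: tapes_over_def)
    then have "represents (i \<in> S) (ts ! i) (Suc c)" using Suc.prems by (metis registers_def)
    from represents_head[OF this] have h: "(ts ! i) 0 = 1" by simp
    obtain ts1 where 1: "halts_with (compile K g (Dec i)) ts ts1" "registers S (\<sigma>(i := c)) ts1"
      using halts_with_Dec[OF l Suc.prems(3,1)] by blast
    have t1: "tapes_over K g ts1" using halts_with_tapes_over[OF d 1(1) Suc.prems(2)] .
    obtain ts2 where 2: "halts_with (compile K g p) ts1 ts2" "registers S (run p (\<sigma>(i := c))) ts2"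
      using Loop.IH[OF _ _ _ _ t1 1(2)] Loop.prems(1-4) unfolding loop_wf.simps regs.simps by blast
    have t2: "tapes_over K g ts2" using halts_with_tapes_over[OF p 2(1) t1] .
    \<comment> \<open>The body does not touch the counter, so the next round starts with one stroke less.\<close>
    have "run p (\<sigma>(i := c)) i = c" using Loop.prems by (simp add: run_unused)
    then obtain ts3 where 3: "halts_with (tm_while i B) ts2 ts3"
      "registers S ((run p ^^ c) ((run p (\<sigma>(i := c)))(i := 0))) ts3"
      using Suc.IH[OF _ t2 2(2)] by blast
    have "(run p (\<sigma>(i := c)))(i := 0) = run p (\<sigma>(i := 0))"
      using Loop.prems by (simp add: run_update_commute)
    then have "registers S ((run p ^^ Suc c) (\<sigma>(i := 0))) ts3"
      using 3(2) by (simp add: funpow_swap1)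
    moreover have "halts_with B ts ts2"
      unfolding B_def by (rule halts_with_seq[OF d p Suc.prems(2) 1(1) 2(1)])
    then have "halts_with (tm_while i B) ts ts3"
      using halts_with_while_iterate[OF B Suc.prems(2) _ h _ 3(1)] l Suc.prems(2) by (simp add: tapes_over_def)
    ultimately show ?case by blast
  qed
  from this[OF refl Loop.prems(5,6)] show ?case by (simp add: B_def)
qed

section \<open>Functions computed by machines\<close>

definition input_tapes :: "nat \<Rightarrow> nat list \<Rightarrow> tape list" where
  "input_tapes K xs = map nat_tape xs @ replicate (K - length xs) blank_tape"

text \<open>
  Only argument lists of length \<open>m\<close> matter. Working with lists of inputs and
  outputs makes composition and the passing on of further arguments a matter of concatenating
  lists.
\<close>

definition tm_computable :: "nat \<Rightarrow> nat \<Rightarrow> (nat list \<Rightarrow> nat list) \<Rightarrow> bool" where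
  "tm_computable m n F \<longleftrightarrow> (\<exists>M. tm_wf M \<and>
     (\<forall>xs. length xs = m \<longrightarrow> length (F xs) = n \<and> tm_yields M (map nat_tape xs) (F xs)))"

lemma blank_tape_eq: "blank_tape = nat_tape 0"
  by (auto simp: blank_tape_def nat_tape_def)

lemma input_tapes_eq:
  "length xs \<le> K \<Longrightarrow> input_tapes K xs = map (\<lambda>i. nat_tape (if i < length xs then xs ! i else 0)) [0..<K]"
  by (rule nth_equalityI) (auto simp: input_tapes_def nth_append blank_tape_eq)

lemma tapes_over_input: "2 \<le> g \<Longrightarrow> length xs \<le> K \<Longrightarrow> tapes_over K g (input_tapes K xs)"
  by (auto simp: input_tapes_def tapes_over_def nat_tape_def blank_tape_def)

lemma registers_input:
  "length xs \<le> K \<Longrightarrow> registers UNIV (\<lambda>i. if i < length xs then xs ! i else 0) (input_tapes K xs)"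
  by (simp add: input_tapes_eq registers_def represents_def)

lemma registers_exact:
  assumes "registers S \<sigma> ts" "K \<le> length ts" "{..<K} \<subseteq> S"
  shows "take K ts = map (\<lambda>i. nat_tape (\<sigma> i)) [0..<K]"
  by (rule nth_equalityI) (use assms in \<open>force simp: registers_def represents_def\<close>)+

text \<open>
  Finite inputs leave infinitely many cells without stroke, hence the values read off the output
  tapes are actually present there.
\<close>

lemma tm_yields_iff:
  assumes "tm_wf M"
  shows "tm_yields M (map nat_tape xs) ys \<longleftrightarrow> length xs \<le> tm_tapes M \<and> length ys \<le> tm_tapes M \<and>
    (\<exists>ts. halts_with M (input_tapes (tm_tapes M) xs) ts \<and> (\<forall>i<length ys. holds (ts ! i) (ys ! i)))"
    (is "?L \<longleftrightarrow> ?R")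
proof -
  define K where "K = tm_tapes M"
  have M: "tm_over K (tm_symbols M) M" using assms by (simp add: tm_over_def K_def)
  have len: "length ts = K" if "halts_with M (input_tapes K xs) ts" "length xs \<le> K" for ts
    using halts_with_tapes_over[OF M that(1) tapes_over_input] that(2) tm_overD(6)[OF M]
    by (simp add: tapes_over_def)
  have eq: "(\<exists>n. (tm_step M ^^ n) (0, map nat_tape xs @ replicate (K - length xs) blank_tape) = (tm_final M, ts))
    \<longleftrightarrow> halts_with M (input_tapes K xs) ts" for ts
    by (simp add: halts_with_def reaches_def input_tapes_def)
  have gaps: "\<forall>t\<in>set (input_tapes K xs). unbounded_gaps t"
    by (auto simp: input_tapes_def blank_tape_eq unbounded_gaps_nat_tape)
  show ?thesis
  proof
    assume L: ?L
    then obtain ts where l: "length xs \<le> K" "length ys \<le> K" and ts: "halts_with M (input_tapes K xs) ts"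
      "map tape_value (take (length ys) ts) = ys"
      unfolding tm_yields_def K_def[symmetric] using eq by auto
    have "holds (ts ! i) (ys ! i)" if "i < length ys" for i
    proof -
      have "i < length ts" using that l len[OF ts(1)] by simp
      then have "unbounded_gaps (ts ! i)" using unbounded_gaps_halts_with[OF ts(1) gaps] by simp
      moreover have "ys ! i = tape_value (ts ! i)"
        using that \<open>i < length ts\<close> arg_cong[OF ts(2), of "\<lambda>l. l ! i"] by simp
      ultimately show ?thesis using unbounded_gaps_holds by simp
    qed
    then show ?R using l ts(1) by (auto simp: K_def)
  next
    assume ?R
    then obtain ts where l: "length xs \<le> K" "length ys \<le> K" and ts: "halts_with M (input_tapes K xs) ts"
      "\<forall>i<length ys. holds (ts ! i) (ys ! i)"
      unfolding K_def[symmetric] by auto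
    have "map tape_value (take (length ys) ts) = ys"
      by (rule nth_equalityI) (use l ts len holds_tape_value in auto)
    then show ?L
      unfolding tm_yields_def K_def[symmetric] using eq[of ts] l ts(1) by auto
  qed
qed

lemma tm_computableI:
  assumes "tm_over K g M" "m \<le> K" "n \<le> K"
    and "\<And>xs. length xs = m \<Longrightarrow> length (F xs) = n \<and>
      (\<exists>ts. halts_with M (input_tapes K xs) ts \<and> (\<forall>i<n. holds (ts ! i) (F xs ! i)))"
  shows "tm_computable m n F"
  unfolding tm_computable_def
proof (intro exI[of _ M] conjI allI impI)
  note M = tm_overD[OF assms(1)]
  show "tm_wf M" by (rule M(1))
  fix xs :: "nat list" assume l: "length xs = m"
  show "length (F xs) = n" using assms(4)[OF l] by blast
  then show "tm_yields M (map nat_tape xs) (F xs)"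
    unfolding tm_yields_iff[OF M(1)] M(2) using assms(2,3) assms(4)[OF l] l by auto
qed

lemma tm_computableE:
  assumes "tm_computable m n F"
  obtains M where "tm_wf M" "m \<le> tm_tapes M" "n \<le> tm_tapes M"
    "\<forall>xs. length xs = m \<longrightarrow> length (F xs) = n \<and>
      (\<exists>ts. halts_with M (input_tapes (tm_tapes M) xs) ts \<and> (\<forall>i<n. holds (ts ! i) (F xs ! i)))"
proof -
  obtain M where M: "tm_wf M"
    "\<And>xs. length xs = m \<Longrightarrow> length (F xs) = n \<and> tm_yields M (map nat_tape xs) (F xs)"
    using assms unfolding tm_computable_def by blast
  note Y = M(2)[unfolded tm_yields_iff[OF M(1)]]
  show ?thesis
  proof (rule that[OF M(1)])
    show "m \<le> tm_tapes M" "n \<le> tm_tapes M"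
      using Y[of "replicate m 0"] by simp_all
  next
    show "\<forall>xs. length xs = m \<longrightarrow> length (F xs) = n \<and>
      (\<exists>ts. halts_with M (input_tapes (tm_tapes M) xs) ts \<and> (\<forall>i<n. holds (ts ! i) (F xs ! i)))"
      using Y by metis
  qed
qed

text \<open>
  Inputs and outputs both occupy the first tapes, so a machine shifted by \<open>j\<close> tapes
  leaves \<open>j\<close> further arguments in front of its inputs untouched and in front of its
  outputs.
\<close>

lemma tm_computable_frame:
  assumes "tm_computable m n F"
  shows "tm_computable (j + m) (j + n) (\<lambda>xs. take j xs @ F (drop j xs))"
proof -
  from assms obtain M where M: "tm_wf M" "m \<le> tm_tapes M" "n \<le> tm_tapes M"
    "\<forall>xs. length xs = m \<longrightarrow> length (F xs) = n \<and>
      (\<exists>ts. halts_with M (input_tapes (tm_tapes M) xs) ts \<and> (\<forall>i<n. holds (ts ! i) (F xs ! i)))"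
    by (rule tm_computableE)
  define K where "K = tm_tapes M"
  have M2: "2 \<le> tm_symbols M" using M(1) by (simp add: tm_wf_def)
  show ?thesis
  proof (rule tm_computableI)
    show "tm_over (j + K) (tm_symbols M) (tm_lift j (j + K) (tm_symbols M) M)"
      by (rule tm_over_lift) (use M in \<open>auto simp: K_def\<close>)
  next
    fix xs :: "nat list" assume l: "length xs = j + m"
    then have "length (drop j xs) = m" by simp
    from M(4)[rule_format, OF this] obtain ts where ts: "length (F (drop j xs)) = n"
      "halts_with M (input_tapes K (drop j xs)) ts" "\<forall>i<n. holds (ts ! i) (F (drop j xs) ! i)"
      unfolding K_def by blast
    have "tapes_over K (tm_symbols M) (input_tapes K (drop j xs))"
      by (rule tapes_over_input) (use l M M2 in \<open>auto simp: K_def\<close>)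
    then have "halts_with (tm_lift (length (map nat_tape (take j xs))) (j + K) (tm_symbols M) M)
        (map nat_tape (take j xs) @ input_tapes K (drop j xs) @ []) (map nat_tape (take j xs) @ ts @ [])"
      unfolding K_def using M(1) ts(2) by (intro halts_with_lift) (auto simp: K_def)
    moreover have "map nat_tape (take j xs) @ input_tapes K (drop j xs) = input_tapes (j + K) xs"
      using l by (simp add: input_tapes_def flip: map_append append_assoc)
    ultimately have "halts_with (tm_lift j (j + K) (tm_symbols M) M) (input_tapes (j + K) xs)
        (map nat_tape (take j xs) @ ts)"
      using l by simp
    moreover have "holds ((map nat_tape (take j xs) @ ts) ! i) ((take j xs @ F (drop j xs)) ! i)"
      if "i < j + n" for i
      using that ts(3) l by (auto simp: nth_append holds_nat_tape)
    ultimately show "length (take j xs @ F (drop j xs)) = j + n \<and>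
      (\<exists>ts. halts_with (tm_lift j (j + K) (tm_symbols M) M) (input_tapes (j + K) xs) ts \<and>
        (\<forall>i<j + n. holds (ts ! i) ((take j xs @ F (drop j xs)) ! i)))"
      using l ts(1) by auto
  qed (use M in \<open>auto simp: K_def\<close>)
qed

fun move_block :: "nat \<Rightarrow> nat \<Rightarrow> nat \<Rightarrow> loop_prog" where
  "move_block s d 0 = Skip"
| "move_block s d (Suc n) = Seq (move_block s d n) (Loop (s + n) (Inc (d + n)))"

lemma run_Inc_iter: "(run (Inc i) ^^ n) \<sigma> = \<sigma>(i := \<sigma> i + n)"
  by (induction n) auto

lemma run_Dec_iter: "(run (Dec i) ^^ n) \<sigma> = \<sigma>(i := \<sigma> i - n)"
  by (induction n) auto

lemma run_Skip_iter: "(run Skip ^^ n) \<sigma> = \<sigma>"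
  by (induction n) auto

lemma regs_move_block: "regs (move_block s d n) \<subseteq> {s..<s + n} \<union> {d..<d + n}"
  by (induction n) auto

lemma loop_wf_move_block: "s + n \<le> d \<or> d + n \<le> s \<Longrightarrow> loop_wf (move_block s d n)"
  by (induction n) auto

lemma run_move_block:
  assumes "s + n \<le> d \<or> d + n \<le> s" "\<And>i. d \<le> i \<Longrightarrow> i < d + n \<Longrightarrow> \<sigma> i = 0"
  shows "run (move_block s d n) \<sigma> =
    (\<lambda>i. if d \<le> i \<and> i < d + n then \<sigma> (s + (i - d)) else if s \<le> i \<and> i < s + n then 0 else \<sigma> i)"
  using assms
proof (induction n)
  case (Suc n)
  have IH: "run (move_block s d n) \<sigma> = (\<lambda>i. if d \<le> i \<and> i < d + n then \<sigma> (s + (i - d))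
      else if s \<le> i \<and> i < s + n then 0 else \<sigma> i)"
    by (rule Suc.IH) (use Suc.prems in auto)
  have "s + n \<noteq> d + n" "\<sigma> (d + n) = 0" using Suc.prems by auto
  then show ?case
    unfolding move_block.simps run.simps(4,5) IH run_Inc_iter
    using Suc.prems by (intro ext) (auto simp: less_Suc_eq)
qed auto

text \<open>
  The second machine needs exact inputs and blank work tapes. It therefore gets the front tapes:
  the inputs are first moved away to a block further right, where the first machine runs, and
  then its (inexact) outputs are moved back into the emptied front tapes. Moving counts up from
  blank and so produces exact tapes again.
\<close>

lemma tm_computable_compose:
  assumes "tm_computable m k F" "tm_computable k n G"
  shows "tm_computable m n (\<lambda>xs. G (F xs))"
proof -
  from assms(1) obtain A where A: "tm_wf A" "m \<le> tm_tapes A" "k \<le> tm_tapes A"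
    "\<forall>xs. length xs = m \<longrightarrow> length (F xs) = k \<and>
      (\<exists>ts. halts_with A (input_tapes (tm_tapes A) xs) ts \<and> (\<forall>i<k. holds (ts ! i) (F xs ! i)))"
    by (rule tm_computableE)
  from assms(2) obtain B where B: "tm_wf B" "k \<le> tm_tapes B" "n \<le> tm_tapes B"
    "\<forall>xs. length xs = k \<longrightarrow> length (G xs) = n \<and>
      (\<exists>ts. halts_with B (input_tapes (tm_tapes B) xs) ts \<and> (\<forall>i<n. holds (ts ! i) (G xs ! i)))"
    by (rule tm_computableE)
  \<comment> \<open>The first machine must run beyond the tapes of the second and beyond the inputs.\<close>
  define d where "d = max (tm_tapes B) m"
  \<comment> \<open>One spare tape makes the number of tapes positive, as the compiled programs require.\<close>
  define K where "K = Suc (d + tm_tapes A)"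
  define g where "g = max (tm_symbols A) (tm_symbols B)"
  define P where "P = move_block 0 d m"
  define Q where "Q = move_block d 0 k"
  have g: "2 \<le> tm_symbols A" "2 \<le> tm_symbols B" "2 \<le> g"
    using A(1) B(1) by (auto simp: tm_wf_def g_def)
  have dk: "m \<le> d" "k \<le> d" "tm_tapes B \<le> d" "0 < K" using A B by (auto simp: d_def K_def)
  have regs: "regs P \<subseteq> {..<K}" "regs Q \<subseteq> {..<K}" and wf: "loop_wf P" "loop_wf Q"
    unfolding P_def Q_def K_def using dk A
      regs_move_block[of 0 d m] regs_move_block[of d 0 k] by (auto intro!: loop_wf_move_block)
  define T1 where "T1 = compile K g P"
  define T2 where "T2 = tm_lift d K g A"
  define T3 where "T3 = compile K g Q"
  define T4 where "T4 = tm_lift 0 K g B"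
  have T: "tm_over K g T1" "tm_over K g T2" "tm_over K g T3" "tm_over K g T4"
    unfolding T1_def T2_def T3_def T4_def using regs g dk A(1) B(1)
    by (auto intro!: tm_over_compile tm_over_lift simp: K_def g_def)
  have T34: "tm_over K g (tm_seq T3 T4)" and T234: "tm_over K g (tm_seq T2 (tm_seq T3 T4))"
    by (intro tm_over_seq T)+
  show ?thesis
  proof (rule tm_computableI)
    show "tm_over K g (tm_seq T1 (tm_seq T2 (tm_seq T3 T4)))" by (intro tm_over_seq T)
    show "m \<le> K" "n \<le> K" using dk B by (auto simp: K_def)
  next
    fix xs :: "nat list" assume l: "length xs = m"
    let ?in = "input_tapes K xs"
    have t0: "tapes_over K g ?in" by (rule tapes_over_input) (use g l dk in \<open>auto simp: K_def\<close>)
    obtain ts1 where h1: "halts_with T1 ?in ts1"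
      and r1: "registers UNIV (run P (\<lambda>i. if i < length xs then xs ! i else 0)) ts1"
      using compile_correct[OF wf(1) regs(1) g(3) dk(4) t0 registers_input] l dk
      unfolding T1_def K_def by auto
    have t1: "tapes_over K g ts1" using halts_with_tapes_over[OF T(1) h1 t0] .
    have "run P (\<lambda>i. if i < length xs then xs ! i else 0) =
        (\<lambda>i. if d \<le> i \<and> i < d + m then xs ! (i - d) else 0)"
      unfolding P_def by (subst run_move_block) (use l dk in \<open>auto simp: fun_eq_iff\<close>)
    note r1 = r1[unfolded this]
    have ts1: "ts1 = replicate d blank_tape @ input_tapes (tm_tapes A) xs @ [blank_tape]"
    proof -
      have "ts1 = map (\<lambda>i. nat_tape (if d \<le> i \<and> i < d + m then xs ! (i - d) else 0)) [0..<K]"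
        using registers_exact[OF r1, of K] t1 by (simp add: tapes_over_def)
      also have "\<dots> = replicate d blank_tape @ input_tapes (tm_tapes A) xs @ [blank_tape]"
        by (rule nth_equalityI)
          (use A(2) l in \<open>auto simp: K_def nth_append input_tapes_def blank_tape_eq\<close>)
      finally show ?thesis .
    qed
    obtain us where us: "halts_with A (input_tapes (tm_tapes A) xs) us" "\<forall>i<k. holds (us ! i) (F xs ! i)"
      and lF: "length (F xs) = k"
      using A(4) l by blast
    have tA: "tapes_over (tm_tapes A) (tm_symbols A) (input_tapes (tm_tapes A) xs)"
      by (rule tapes_over_input) (use g l A in auto)
    have lus: "length us = tm_tapes A"
      using halts_with_tapes_over[OF _ us(1) tA] A(1) by (simp add: tm_over_def tapes_over_def)
    define ts2 where "ts2 = replicate d blank_tape @ us @ [blank_tape]"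
    have h2: "halts_with T2 ts1 ts2"
      using halts_with_lift[OF A(1) tA us(1), of "replicate d blank_tape" K g "[blank_tape]"]
      unfolding ts1 ts2_def T2_def by simp
    have t2: "tapes_over K g ts2" using halts_with_tapes_over[OF T(2) h2 t1] .
    have gaps: "\<forall>t\<in>set us. unbounded_gaps t"
      by (rule unbounded_gaps_halts_with[OF us(1)])
        (auto simp: input_tapes_def blank_tape_eq unbounded_gaps_nat_tape)
    define \<sigma> where "\<sigma> i = (if d \<le> i \<and> i < d + tm_tapes A then tape_value (us ! (i - d)) else 0)" for i
    have r2: "registers {..<d} \<sigma> ts2"
      unfolding registers_def
      using gaps lus
      by (auto simp: \<sigma>_def ts2_def represents_def nth_append blank_tape_eq holds_nat_tape
          intro!: unbounded_gaps_holds)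
    obtain ts3 where h3: "halts_with T3 ts2 ts3" and r3: "registers {..<d} (run Q \<sigma>) ts3"
      using compile_correct[OF wf(2) regs(2) g(3) dk(4) t2 r2] unfolding T3_def by auto
    have t3: "tapes_over K g ts3" using halts_with_tapes_over[OF T(3) h3 t2] .
    have "run Q \<sigma> i = (if i < k then F xs ! i else 0)" if "i < d" for i
    proof -
      have "\<sigma> (d + i) = F xs ! i" if "i < k"
        using that us(2) A(3) by (auto simp: \<sigma>_def holds_tape_value)
      moreover have "\<sigma> i = 0" if "i < d" for i using that by (simp add: \<sigma>_def)
      ultimately show ?thesis
        unfolding Q_def by (subst run_move_block) (use that dk in auto)
    qed
    then have "take (tm_tapes B) ts3 = input_tapes (tm_tapes B) (F xs)"
      using registers_exact[OF r3, of "tm_tapes B"] t3 dk lF B(2)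
      by (auto simp: tapes_over_def K_def input_tapes_eq)
    then have ts3: "ts3 = [] @ input_tapes (tm_tapes B) (F xs) @ drop (tm_tapes B) ts3"
      by (metis append_Nil append_take_drop_id)
    obtain vs where vs: "halts_with B (input_tapes (tm_tapes B) (F xs)) vs" "\<forall>i<n. holds (vs ! i) (G (F xs) ! i)"
      and lG: "length (G (F xs)) = n"
      using B(4) lF by blast
    have tB: "tapes_over (tm_tapes B) (tm_symbols B) (input_tapes (tm_tapes B) (F xs))"
      by (rule tapes_over_input) (use g lF B in auto)
    have lvs: "length vs = tm_tapes B"
      using halts_with_tapes_over[OF _ vs(1) tB] B(1) by (simp add: tm_over_def tapes_over_def)
    have h4: "halts_with T4 ts3 ([] @ vs @ drop (tm_tapes B) ts3)"
      unfolding T4_def by (subst ts3) (use halts_with_lift[OF B(1) tB vs(1), of "[]" K g] in simp)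
    have "halts_with (tm_seq T1 (tm_seq T2 (tm_seq T3 T4))) ?in ([] @ vs @ drop (tm_tapes B) ts3)"
      by (rule halts_with_seq[OF T(1) T234 t0 h1 halts_with_seq[OF T(2) T34 t1 h2
            halts_with_seq[OF T(3,4) t2 h3 h4]]])
    then show "length (G (F xs)) = n \<and> (\<exists>ts. halts_with (tm_seq T1 (tm_seq T2 (tm_seq T3 T4))) ?in ts \<and>
        (\<forall>i<n. holds (ts ! i) (G (F xs) ! i)))"
      using lG vs(2) lvs B(3)
      by (intro conjI exI[of _ "[] @ vs @ drop (tm_tapes B) ts3"]) (auto simp: nth_append)
  qed
qed

text \<open>
  The result is delivered in any prescribed register \<open>d\<close> beyond the arguments, with
  all scratch registers above \<open>d\<close> returned empty and the arguments intact. This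
  form lets evaluations be stacked on top of each other. Applying \<open>F\<close> to the list
  of the first \<open>m\<close> registers makes it manifest that only these matter.
\<close>

definition loop_computable :: "nat \<Rightarrow> (nat list \<Rightarrow> nat) \<Rightarrow> bool" where
  "loop_computable m F \<longleftrightarrow> (\<forall>d\<ge>m. \<exists>p. loop_wf p \<and>
     (\<forall>\<sigma>. (\<forall>i\<ge>d. \<sigma> i = 0) \<longrightarrow> run p \<sigma> = \<sigma>(d := F (map \<sigma> [0..<m]))))"

text \<open>
  Evaluate the operands into registers \<open>d\<close> and \<open>d + 1\<close>, then combine
  them in place.
\<close>

lemma loop_computable_binary:
  assumes q: "\<And>d. \<exists>q. loop_wf q \<and>
      (\<forall>\<sigma>. (\<forall>i\<ge>d + 2. \<sigma> i = 0) \<longrightarrow> run q \<sigma> = \<sigma>(d := h (\<sigma> d) (\<sigma> (d + 1)), d + 1 := 0))"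
    and F: "loop_computable m F" and G: "loop_computable m G"
  shows "loop_computable m (\<lambda>xs. h (F xs) (G xs))"
  unfolding loop_computable_def
proof (intro allI impI)
  fix d assume d: "m \<le> d"
  obtain q where q: "loop_wf q"
    "\<And>\<sigma>. (\<forall>i\<ge>d + 2. \<sigma> i = 0) \<Longrightarrow> run q \<sigma> = \<sigma>(d := h (\<sigma> d) (\<sigma> (d + 1)), d + 1 := 0)"
    using q[of d] by blast
  obtain p1 where p1: "loop_wf p1" "\<And>\<sigma>. (\<forall>i\<ge>d. \<sigma> i = 0) \<Longrightarrow> run p1 \<sigma> = \<sigma>(d := F (map \<sigma> [0..<m]))"
    using F d unfolding loop_computable_def by blast
  obtain p2 where p2: "loop_wf p2"
    "\<And>\<sigma>. (\<forall>i\<ge>d + 1. \<sigma> i = 0) \<Longrightarrow> run p2 \<sigma> = \<sigma>(d + 1 := G (map \<sigma> [0..<m]))"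
    using G d unfolding loop_computable_def by (metis le_add1 le_trans)
  have "run (Seq p1 (Seq p2 q)) \<sigma> = \<sigma>(d := h (F (map \<sigma> [0..<m])) (G (map \<sigma> [0..<m])))"
    if z: "\<forall>i\<ge>d. \<sigma> i = 0" for \<sigma>
  proof -
    let ?\<sigma>1 = "\<sigma>(d := F (map \<sigma> [0..<m]))"
    have "map ?\<sigma>1 [0..<m] = map \<sigma> [0..<m]" using d by simp
    moreover have "run p2 ?\<sigma>1 = ?\<sigma>1(d + 1 := G (map ?\<sigma>1 [0..<m]))"
      by (rule p2(2)) (use z in auto)
    ultimately have 2: "run p2 ?\<sigma>1 = ?\<sigma>1(d + 1 := G (map \<sigma> [0..<m]))" (is "_ = ?\<sigma>2")
      by (simp only:)
    have "run q ?\<sigma>2 = ?\<sigma>2(d := h (?\<sigma>2 d) (?\<sigma>2 (d + 1)), d + 1 := 0)"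
      by (rule q(2)) (use z in auto)
    then show ?thesis
      unfolding run.simps p1(2)[OF z] 2 using z by (auto simp: fun_eq_iff)
  qed
  then show "\<exists>p. loop_wf p \<and> (\<forall>\<sigma>. (\<forall>i\<ge>d. \<sigma> i = 0) \<longrightarrow>
      run p \<sigma> = \<sigma>(d := h (F (map \<sigma> [0..<m])) (G (map \<sigma> [0..<m]))))"
    using p1(1) p2(1) q(1) by (intro exI[of _ "Seq p1 (Seq p2 q)"]) auto
qed

lemma loop_computable_const: "loop_computable m (\<lambda>xs. c)"
  unfolding loop_computable_def
proof (intro allI impI)
  fix d
  show "\<exists>p. loop_wf p \<and> (\<forall>\<sigma>. (\<forall>i\<ge>d. \<sigma> i = 0) \<longrightarrow> run p \<sigma> = \<sigma>(d := c))"
  proof (induction c)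
    case 0
    show ?case by (rule exI[of _ Skip]) auto
  next
    case (Suc c)
    then obtain p where "loop_wf p" "\<forall>\<sigma>. (\<forall>i\<ge>d. \<sigma> i = 0) \<longrightarrow> run p \<sigma> = \<sigma>(d := c)" by blast
    then show ?case by (intro exI[of _ "Seq p (Inc d)"]) auto
  qed
qed

text \<open>
  A loop destroys its counter, so copying register \<open>i\<close> to \<open>d\<close> makes a
  second copy in \<open>e\<close> that is moved back to \<open>i\<close>.
\<close>

definition add_copy :: "nat \<Rightarrow> nat \<Rightarrow> nat \<Rightarrow> loop_prog" where
  "add_copy i d e = Seq (Loop i (Seq (Inc d) (Inc e))) (Loop e (Inc i))"

lemma loop_wf_add_copy: "distinct [i, d, e] \<Longrightarrow> loop_wf (add_copy i d e)"
  by (auto simp: add_copy_def)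

lemma regs_add_copy: "regs (add_copy i d e) = {i, d, e}"
  by (auto simp: add_copy_def)

lemma run_add_copy:
  assumes "distinct [i, d, e]" "\<sigma> e = 0"
  shows "run (add_copy i d e) \<sigma> = \<sigma>(d := \<sigma> d + \<sigma> i)"
proof -
  have "(run (Seq (Inc d) (Inc e)) ^^ n) \<tau> = \<tau>(d := \<tau> d + n, e := \<tau> e + n)" for n \<tau>
  proof (induction n)
    case (Suc n)
    show ?case
      unfolding funpow.simps o_apply Suc unfolding run.simps using assms by (auto simp: fun_eq_iff)
  qed simp
  then show ?thesis
    unfolding add_copy_def run.simps(4) run.simps(5) run_Inc_iter using assms by (auto simp: fun_eq_iff)
qed

lemma loop_computable_nth:
  assumes "i < m"
  shows "loop_computable m (\<lambda>xs. xs ! i)"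
  unfolding loop_computable_def
proof (intro allI impI)
  fix d assume d: "m \<le> d"
  show "\<exists>p. loop_wf p \<and> (\<forall>\<sigma>. (\<forall>i\<ge>d. \<sigma> i = 0) \<longrightarrow> run p \<sigma> = \<sigma>(d := map \<sigma> [0..<m] ! i))"
    by (rule exI[of _ "add_copy i d (d + 1)"]) (use d assms in \<open>auto simp: loop_wf_add_copy run_add_copy\<close>)
qed

lemma loop_computable_add:
  assumes "loop_computable m F" "loop_computable m G"
  shows "loop_computable m (\<lambda>xs. F xs + G xs)"
proof (rule loop_computable_binary[OF _ assms])
  fix d
  have "run (Loop (d + 1) (Inc d)) \<sigma> = \<sigma>(d := \<sigma> d + \<sigma> (d + 1), d + 1 := 0)" for \<sigma>
    unfolding run.simps(5) run_Inc_iter by auto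
  then show "\<exists>q. loop_wf q \<and> (\<forall>\<sigma>. (\<forall>i\<ge>d + 2. \<sigma> i = 0) \<longrightarrow>
      run q \<sigma> = \<sigma>(d := \<sigma> d + \<sigma> (d + 1), d + 1 := 0))"
    by (intro exI[of _ "Loop (d + 1) (Inc d)"]) auto
qed

lemma loop_computable_Suc: "loop_computable m F \<Longrightarrow> loop_computable m (\<lambda>xs. Suc (F xs))"
  using loop_computable_add[OF _ loop_computable_const[of m 1]] by simp

lemma loop_computable_diff:
  assumes "loop_computable m F" "loop_computable m G"
  shows "loop_computable m (\<lambda>xs. F xs - G xs)"
proof (rule loop_computable_binary[OF _ assms])
  fix d
  have "run (Loop (d + 1) (Dec d)) \<sigma> = \<sigma>(d := \<sigma> d - \<sigma> (d + 1), d + 1 := 0)" for \<sigma>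
    unfolding run.simps(5) run_Dec_iter by auto
  then show "\<exists>q. loop_wf q \<and> (\<forall>\<sigma>. (\<forall>i\<ge>d + 2. \<sigma> i = 0) \<longrightarrow>
      run q \<sigma> = \<sigma>(d := \<sigma> d - \<sigma> (d + 1), d + 1 := 0))"
    by (intro exI[of _ "Loop (d + 1) (Dec d)"]) auto
qed

lemma loop_computable_mult:
  assumes "loop_computable m F" "loop_computable m G"
  shows "loop_computable m (\<lambda>xs. F xs * G xs)"
proof (rule loop_computable_binary[OF _ assms])
  fix d
  let ?c = "add_copy (d + 1) d (d + 3)"
  \<comment> \<open>Move the first factor away, then add the second factor that many times, then discard the latter.\<close>
  let ?q = "Seq (Loop d (Inc (d + 2))) (Seq (Loop (d + 2) ?c) (Loop (d + 1) Skip))"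
  have "run ?q \<sigma> = \<sigma>(d := \<sigma> d * \<sigma> (d + 1), d + 1 := 0)" if z: "\<forall>i\<ge>d + 2. \<sigma> i = 0" for \<sigma>
  proof -
    have it: "(run ?c ^^ n) \<tau> = \<tau>(d := \<tau> d + n * \<tau> (d + 1))" if "\<tau> (d + 3) = 0" for n \<tau>
    proof (induction n)
      case (Suc n)
      show ?case
        unfolding funpow.simps o_apply Suc
        by (subst run_add_copy) (use that in \<open>auto simp: fun_eq_iff\<close>)
    qed simp
    have "run (Loop d (Inc (d + 2))) \<sigma> = \<sigma>(d := 0, d + 2 := \<sigma> d)"
      unfolding run.simps(5) run_Inc_iter using z by auto
    moreover have "run (Loop (d + 2) ?c) (\<sigma>(d := 0, d + 2 := \<sigma> d)) = \<sigma>(d := \<sigma> d * \<sigma> (d + 1))"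
      unfolding run.simps(5) by (subst it) (use z in \<open>auto simp: fun_eq_iff\<close>)
    ultimately show ?thesis
      unfolding run.simps(4) by (simp only: run.simps(5) run_Skip_iter)
  qed
  then show "\<exists>q. loop_wf q \<and> (\<forall>\<sigma>. (\<forall>i\<ge>d + 2. \<sigma> i = 0) \<longrightarrow>
      run q \<sigma> = \<sigma>(d := \<sigma> d * \<sigma> (d + 1), d + 1 := 0))"
    by (intro exI[of _ ?q]) (auto simp: loop_wf_add_copy regs_add_copy)
qed

lemma loop_computable_parity:
  assumes "loop_computable m F"
  shows "loop_computable m (\<lambda>xs. F xs mod 2)"
proof (rule loop_computable_binary[OF _ assms loop_computable_const[of _ 0], of "\<lambda>x y. x mod 2"])
  fix d
  \<comment> \<open>The program \<open>?t\<close> replaces register \<open>d\<close> by \<open>1 - d\<close>, which flips a bit.\<close>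
  let ?t = "Seq (Inc (d + 2)) (Seq (Loop d (Dec (d + 2))) (Loop (d + 2) (Inc d)))"
  let ?q = "Seq (Loop (d + 1) Skip) (Seq (Loop d (Inc (d + 1))) (Loop (d + 1) ?t))"
  have "run ?q \<sigma> = \<sigma>(d := \<sigma> d mod 2, d + 1 := 0)" if z: "\<forall>i\<ge>d + 2. \<sigma> i = 0" for \<sigma>
  proof -
    have t: "run ?t \<tau> = \<tau>(d := 1 - \<tau> d)" if "\<tau> (d + 2) = 0" for \<tau>
      unfolding run.simps(2,4,5) run_Inc_iter run_Dec_iter using that by (auto simp: fun_eq_iff)
    have it: "(run ?t ^^ n) \<tau> = \<tau>(d := n mod 2)" if "\<tau> d = 0" "\<tau> (d + 2) = 0" for n \<tau>
    proof (induction n)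
      case (Suc n)
      have "(run ?t ^^ Suc n) \<tau> = run ?t (\<tau>(d := n mod 2))"
        using Suc by (simp only: funpow.simps o_apply)
      also have "\<dots> = \<tau>(d := 1 - n mod 2)"
        by (subst t) (use that in auto)
      also have "1 - n mod 2 = Suc n mod 2" by presburger
      finally show ?case .
    qed (use that in auto)
    have "run (Loop d (Inc (d + 1))) (\<sigma>(d + 1 := 0)) = \<sigma>(d := 0, d + 1 := \<sigma> d)"
      unfolding run.simps(5) run_Inc_iter by auto
    moreover have "run (Loop (d + 1) ?t) (\<sigma>(d := 0, d + 1 := \<sigma> d)) = \<sigma>(d := \<sigma> d mod 2, d + 1 := 0)"
      unfolding run.simps(5) by (subst it) (use z in \<open>auto simp: fun_eq_iff\<close>)
    moreover have "run (Loop (d + 1) Skip) \<sigma> = \<sigma>(d + 1 := 0)"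
      by (simp only: run.simps(5) run_Skip_iter)
    ultimately show ?thesis
      unfolding run.simps(4)[of _ "Seq _ _"] by (simp only: run.simps(4))
  qed
  then show "\<exists>q. loop_wf q \<and> (\<forall>\<sigma>. (\<forall>i\<ge>d + 2. \<sigma> i = 0) \<longrightarrow>
      run q \<sigma> = \<sigma>(d := \<sigma> d mod 2, d + 1 := 0))"
    by (intro exI[of _ ?q]) auto
qed

lemma loop_eval_list:
  assumes "\<forall>F\<in>set L. loop_computable m F" "m \<le> d"
  shows "\<exists>p. loop_wf p \<and> (\<forall>\<sigma>. (\<forall>i\<ge>d. \<sigma> i = 0) \<longrightarrow> run p \<sigma> =
    (\<lambda>i. if d \<le> i \<and> i < d + length L then (L ! (i - d)) (map \<sigma> [0..<m]) else \<sigma> i))"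
  using assms(1)
proof (induction L rule: rev_induct)
  case Nil
  show ?case by (rule exI[of _ Skip]) auto
next
  case (snoc F L)
  let ?st = "\<lambda>\<sigma> L i. if d \<le> i \<and> i < d + length L then (L ! (i - d)) (map \<sigma> [0..<m]) else \<sigma> i"
  obtain p where p: "loop_wf p" "\<And>\<sigma>. (\<forall>i\<ge>d. \<sigma> i = 0) \<Longrightarrow> run p \<sigma> = ?st \<sigma> L"
    using snoc by auto
  have "m \<le> d + length L" using assms(2) by simp
  then obtain q where q: "loop_wf q"
    "\<And>\<sigma>. (\<forall>i\<ge>d + length L. \<sigma> i = 0) \<Longrightarrow> run q \<sigma> = \<sigma>(d + length L := F (map \<sigma> [0..<m]))"
    using snoc.prems unfolding loop_computable_def by auto
  have "run (Seq p q) \<sigma> = ?st \<sigma> (L @ [F])" if z: "\<forall>i\<ge>d. \<sigma> i = 0" for \<sigma>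
  proof -
    have "map (?st \<sigma> L) [0..<m] = map \<sigma> [0..<m]" using assms(2) by simp
    moreover have "run q (?st \<sigma> L) = (?st \<sigma> L)(d + length L := F (map (?st \<sigma> L) [0..<m]))"
      by (rule q(2)) (use z in auto)
    ultimately have "run q (?st \<sigma> L) = (?st \<sigma> L)(d + length L := F (map \<sigma> [0..<m]))"
      by (simp only:)
    then show ?thesis
      unfolding run.simps p(2)[OF z] by (auto simp: fun_eq_iff nth_append)
  qed
  then show ?case using p(1) q(1) by (intro exI[of _ "Seq p q"]) auto
qed

fun clear_block :: "nat \<Rightarrow> loop_prog" where
  "clear_block 0 = Skip"
| "clear_block (Suc n) = Seq (clear_block n) (Loop n Skip)"

lemma loop_wf_clear_block: "loop_wf (clear_block n)"
  by (induction n) auto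

lemma run_clear_block: "run (clear_block n) \<sigma> = (\<lambda>i. if i < n then 0 else \<sigma> i)"
proof (induction n)
  case (Suc n)
  then show ?case
    unfolding clear_block.simps run.simps(4,5) run_Skip_iter by (auto simp: fun_eq_iff)
qed auto

text \<open>
  The results are collected in registers beyond both the arguments and the
  \<open>length L\<close> output registers, because the latter overlap with the arguments; these
  are then cleared and the results moved to the front.
\<close>

lemma tm_computable_loop:
  assumes "\<forall>F\<in>set L. loop_computable m F"
  shows "tm_computable m (length L) (\<lambda>xs. map (\<lambda>F. F xs) L)"
proof -
  define n where "n = length L"
  define d where "d = max m n"
  have d: "m \<le> d" "n \<le> d" by (auto simp: d_def)
  obtain p where p: "loop_wf p" "\<And>\<sigma>. (\<forall>i\<ge>d. \<sigma> i = 0) \<Longrightarrow> run p \<sigma> =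
    (\<lambda>i. if d \<le> i \<and> i < d + n then (L ! (i - d)) (map \<sigma> [0..<m]) else \<sigma> i)"
    using loop_eval_list[OF assms d(1)] unfolding n_def by blast
  define P where "P = Seq p (Seq (clear_block m) (move_block d 0 n))"
  have wf: "loop_wf P" using p(1) d by (auto simp: P_def loop_wf_clear_block loop_wf_move_block)
  define K where "K = Suc (Max (insert d (regs P)))"
  have K: "regs P \<subseteq> {..<K}" "d < K"
    using Max_ge[of "insert d (regs P)"] finite_regs[of P] unfolding K_def by (auto simp: less_Suc_eq_le)
  show ?thesis
  proof (rule tm_computableI)
    show "tm_over K 2 (compile K 2 P)" by (rule tm_over_compile) (use K in auto)
    show "m \<le> K" "length L \<le> K" using K d by (auto simp: n_def)
  next
    fix xs :: "nat list" assume l: "length xs = m"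
    let ?\<sigma> = "\<lambda>i. if i < length xs then xs ! i else 0"
    have "tapes_over K 2 (input_tapes K xs)" "registers UNIV ?\<sigma> (input_tapes K xs)"
      by (intro tapes_over_input registers_input; use l K d in simp)+
    then obtain ts where h: "halts_with (compile K 2 P) (input_tapes K xs) ts"
      "registers UNIV (run P ?\<sigma>) ts"
      using compile_correct[OF wf K(1), of 2 "input_tapes K xs" UNIV ?\<sigma>] K(2) by auto
    have "tapes_over K 2 ts"
      by (rule halts_with_tapes_over[OF tm_over_compile[OF K(1)] h(1) tapes_over_input])
        (use K l d in auto)
    then have lts: "length ts = K" by (simp add: tapes_over_def)
    have args: "map ?\<sigma> [0..<m] = xs" by (rule nth_equalityI) (use l in auto)
    have "run P ?\<sigma> i = (L ! i) xs" if "i < n" for i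
      unfolding P_def run.simps(4) run_clear_block
      by (subst p(2); (subst run_move_block)?) (use that d l args in auto)
    then have "holds (ts ! i) (map (\<lambda>F. F xs) L ! i)" if "i < length L" for i
    proof -
      have "i < n" "i < length ts" using that lts K d by (auto simp: n_def)
      then have "represents True (ts ! i) ((L ! i) xs)"
        using h(2) \<open>\<And>i. i < n \<Longrightarrow> run P ?\<sigma> i = (L ! i) xs\<close>[of i] by (auto simp: registers_def)
      then show ?thesis using that by (simp add: represents_holds)
    qed
    then show "length (map (\<lambda>F. F xs) L) = length L \<and>
      (\<exists>ts. halts_with (compile K 2 P) (input_tapes K xs) ts \<and>
        (\<forall>i<length L. holds (ts ! i) (map (\<lambda>F. F xs) L ! i)))"
      using h(1) by auto
  qed
qed

section \<open>Rational sequences and representations\<close>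

lemma tm_computable_cong:
  assumes "tm_computable m n F" "\<And>xs. length xs = m \<Longrightarrow> F xs = G xs"
  shows "tm_computable m n G"
  using assms unfolding tm_computable_def by metis

lemma tm_computable_select:
  assumes "\<forall>i\<in>set is. i < m"
  shows "tm_computable m (length is) (\<lambda>xs. map (\<lambda>i. xs ! i) is)"
proof -
  define L :: "(nat list \<Rightarrow> nat) list" where "L = map (\<lambda>i xs. xs ! i) is"
  have "tm_computable m (length L) (\<lambda>xs. map (\<lambda>F. F xs) L)"
    by (rule tm_computable_loop) (use assms in \<open>auto simp: L_def intro: loop_computable_nth\<close>)
  then show ?thesis by (simp add: L_def comp_def)
qed

text \<open>
  Two functions of the same arguments: duplicate the arguments, apply \<open>G\<close> to the
  second copy, swap, and apply \<open>F\<close> to the remaining copy of the arguments.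
\<close>

lemma tm_computable_append:
  assumes F: "tm_computable m n F" and G: "tm_computable m k G"
  shows "tm_computable m (k + n) (\<lambda>xs. G xs @ F xs)"
proof -
  have lG: "length (G xs) = k" if "length xs = m" for xs
    using G that unfolding tm_computable_def by blast
  have "tm_computable m (m + m) (\<lambda>xs. xs @ xs)"
  proof (rule tm_computable_cong)
    have "\<forall>i\<in>set ([0..<m] @ [0..<m]). i < m" by auto
    from tm_computable_select[OF this]
    show "tm_computable m (m + m) (\<lambda>xs. map (\<lambda>i. xs ! i) ([0..<m] @ [0..<m]))"
      by simp
    show "map (\<lambda>i. xs ! i) ([0..<m] @ [0..<m]) = xs @ xs" if "length xs = m" for xs :: "nat list"
      using that map_nth[of xs] by simp
  qed
  note 1 = tm_computable_compose[OF this tm_computable_frame[OF G, of m]]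
  have 2: "tm_computable (m + k) (k + m) (\<lambda>xs. drop m xs @ take m xs)"
  proof (rule tm_computable_cong)
    have "\<forall>i\<in>set ([m..<m + k] @ [0..<m]). i < m + k" by auto
    from tm_computable_select[OF this]
    show "tm_computable (m + k) (k + m) (\<lambda>xs. map (\<lambda>i. xs ! i) ([m..<m + k] @ [0..<m]))"
      by simp
    show "map (\<lambda>i. xs ! i) ([m..<m + k] @ [0..<m]) = drop m xs @ take m xs"
      if "length xs = m + k" for xs :: "nat list"
      by (rule nth_equalityI) (use that in \<open>auto simp: nth_append\<close>)
  qed
  show ?thesis
    by (rule tm_computable_cong[OF tm_computable_compose[OF tm_computable_compose[OF 1 2]
            tm_computable_frame[OF F, of k]]])
      (use lG in auto)
qed

definition rat_of_triple :: "nat list \<Rightarrow> rat" where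
  "rat_of_triple ys = (- 1) ^ (ys ! 0) * of_nat (ys ! 1) / of_nat (ys ! 2)"

text \<open>
  The common form of the computability of sequences and of double sequences of rationals, with
  the choice of the output triple made explicit as a function.
\<close>

definition rat_computable :: "nat \<Rightarrow> (nat list \<Rightarrow> rat) \<Rightarrow> bool" where
  "rat_computable m \<rho> \<longleftrightarrow> (\<exists>F. tm_computable m 3 F \<and>
     (\<forall>xs. length xs = m \<longrightarrow> F xs ! 2 \<noteq> 0 \<and> \<rho> xs = rat_of_triple (F xs)))"

lemma rat_computable_iff:
  "rat_computable m \<rho> \<longleftrightarrow>
    (\<exists>M. tm_wf M \<and> (\<forall>xs. length xs = m \<longrightarrow> tm_yields_rat M (map nat_tape xs) (\<rho> xs)))"
proof
  assume "rat_computable m \<rho>"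
  then obtain F M where F: "\<And>xs. length xs = m \<Longrightarrow> F xs ! 2 \<noteq> 0 \<and> \<rho> xs = rat_of_triple (F xs)"
    and M: "tm_wf M" "\<And>xs. length xs = m \<Longrightarrow> length (F xs) = 3 \<and> tm_yields M (map nat_tape xs) (F xs)"
    unfolding rat_computable_def tm_computable_def by metis
  have "tm_yields_rat M (map nat_tape xs) (\<rho> xs)" if l: "length xs = m" for xs
  proof -
    have "F xs = [F xs ! 0, F xs ! 1, F xs ! 2]"
      using M(2)[OF l] by (auto simp: numeral_3_eq_3 numeral_2_eq_2 length_Suc_conv)
    then show ?thesis
      using M(2)[OF l] F[OF l] unfolding tm_yields_rat_def rat_of_triple_def by metis
  qed
  then show "\<exists>M. tm_wf M \<and> (\<forall>xs. length xs = m \<longrightarrow> tm_yields_rat M (map nat_tape xs) (\<rho> xs))"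
    using M(1) by blast
next
  assume "\<exists>M. tm_wf M \<and> (\<forall>xs. length xs = m \<longrightarrow> tm_yields_rat M (map nat_tape xs) (\<rho> xs))"
  then obtain M where M: "tm_wf M" "\<And>xs. length xs = m \<Longrightarrow> tm_yields_rat M (map nat_tape xs) (\<rho> xs)"
    by blast
  have "\<forall>xs. \<exists>ys. length xs = m \<longrightarrow> length ys = 3 \<and> tm_yields M (map nat_tape xs) ys \<and>
      ys ! 2 \<noteq> 0 \<and> \<rho> xs = rat_of_triple ys"
  proof (intro allI)
    fix xs
    show "\<exists>ys. length xs = m \<longrightarrow> length ys = 3 \<and> tm_yields M (map nat_tape xs) ys \<and>
      ys ! 2 \<noteq> 0 \<and> \<rho> xs = rat_of_triple ys"
    proof (cases "length xs = m")
      case True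
      then obtain s p q where "tm_yields M (map nat_tape xs) [s, p, q]" "q \<noteq> 0"
        "\<rho> xs = (- 1) ^ s * of_nat p / of_nat q"
        using M(2) unfolding tm_yields_rat_def by blast
      then show ?thesis by (intro exI[of _ "[s, p, q]"]) (simp add: rat_of_triple_def)
    qed simp
  qed
  then obtain F where "\<forall>xs. length xs = m \<longrightarrow> length (F xs) = 3 \<and> tm_yields M (map nat_tape xs) (F xs) \<and>
      F xs ! 2 \<noteq> 0 \<and> \<rho> xs = rat_of_triple (F xs)"
    by metis
  then show "rat_computable m \<rho>"
    unfolding rat_computable_def tm_computable_def using M(1) by blast
qed

lemma computable_rat_seq_iff: "computable_rat_seq r \<longleftrightarrow> rat_computable 1 (\<lambda>xs. r (xs ! 0))"
  unfolding computable_rat_seq_def rat_computable_iff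
proof (intro iff_exI conj_cong refl iffI allI impI)
  fix M and xs :: "nat list" assume "\<forall>k. tm_yields_rat M [nat_tape k] (r k)" "length xs = 1"
  then show "tm_yields_rat M (map nat_tape xs) (r (xs ! 0))"
    by (cases xs) auto
next
  fix M k assume "\<forall>xs. length xs = 1 \<longrightarrow> tm_yields_rat M (map nat_tape xs) (r (xs ! 0))"
  from this[rule_format, of "[k]"] show "tm_yields_rat M [nat_tape k] (r k)" by simp
qed

lemma computable_rat_dseq_iff:
  "computable_rat_dseq r \<longleftrightarrow> rat_computable 2 (\<lambda>xs. r (xs ! 0) (xs ! 1))"
  unfolding computable_rat_dseq_def rat_computable_iff
proof (intro iff_exI conj_cong refl iffI allI impI)
  fix M and xs :: "nat list" assume "\<forall>n k. tm_yields_rat M [nat_tape n, nat_tape k] (r n k)" "length xs = 2"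
  then show "tm_yields_rat M (map nat_tape xs) (r (xs ! 0) (xs ! 1))"
    by (auto simp: numeral_2_eq_2 length_Suc_conv)
next
  fix M n k
  assume "\<forall>xs. length xs = 2 \<longrightarrow> tm_yields_rat M (map nat_tape xs) (r (xs ! 0) (xs ! 1))"
  from this[rule_format, of "[n, k]"] show "tm_yields_rat M [nat_tape n, nat_tape k] (r n k)" by simp
qed

lemma rat_computable_loop:
  assumes "\<forall>h\<in>{s, p, q}. loop_computable m h"
    and "\<And>xs. length xs = m \<Longrightarrow> q xs \<noteq> 0 \<and> \<rho> xs = (- 1) ^ s xs * of_nat (p xs) / of_nat (q xs)"
  shows "rat_computable m \<rho>"
  unfolding rat_computable_def
  using assms tm_computable_loop[of "[s, p, q]" m]
  by (intro exI[of _ "\<lambda>xs. [s xs, p xs, q xs]"]) (auto simp: rat_of_triple_def numeral_3_eq_3)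

lemma rat_computable_reindex:
  assumes "rat_computable m \<rho>" "length L = m" "\<forall>h\<in>set L. loop_computable m' h"
    and "\<And>xs. length xs = m' \<Longrightarrow> \<rho>' xs = \<rho> (map (\<lambda>h. h xs) L)"
  shows "rat_computable m' \<rho>'"
proof -
  obtain F where F: "tm_computable m 3 F"
    "\<And>xs. length xs = m \<Longrightarrow> F xs ! 2 \<noteq> 0 \<and> \<rho> xs = rat_of_triple (F xs)"
    using assms(1) unfolding rat_computable_def by blast
  have "tm_computable m' 3 (\<lambda>xs. F (map (\<lambda>h. h xs) L))"
    using tm_computable_compose[OF _ F(1)] tm_computable_loop[OF assms(3)] assms(2) by auto
  then show ?thesis
    unfolding rat_computable_def using F(2) assms(2,4) by auto
qed

text \<open>
  A binary operation on rationals is computable when it is given by loop computable functions on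
  triples. The hypothesis on values, rather than an identity for all rationals, allows
  operations whose formula is valid only for the arguments that occur.
\<close>

lemma rat_computable_binary:
  assumes "rat_computable m \<rho>1" "rat_computable m \<rho>2"
    and L: "\<forall>h\<in>{s, p, q}. loop_computable 6 h"
    and H: "\<And>xs ys zs. \<lbrakk>length xs = m; length ys = 3; length zs = 3; ys ! 2 \<noteq> 0; zs ! 2 \<noteq> 0;
      \<rho>1 xs = rat_of_triple ys; \<rho>2 xs = rat_of_triple zs\<rbrakk> \<Longrightarrow>
      q (ys @ zs) \<noteq> 0 \<and> \<rho> xs = (- 1) ^ s (ys @ zs) * of_nat (p (ys @ zs)) / of_nat (q (ys @ zs))"
  shows "rat_computable m \<rho>"
proof -
  obtain F1 where F1: "tm_computable m 3 F1"
    "\<And>xs. length xs = m \<Longrightarrow> F1 xs ! 2 \<noteq> 0 \<and> \<rho>1 xs = rat_of_triple (F1 xs)"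
    using assms(1) unfolding rat_computable_def by blast
  obtain F2 where F2: "tm_computable m 3 F2"
    "\<And>xs. length xs = m \<Longrightarrow> F2 xs ! 2 \<noteq> 0 \<and> \<rho>2 xs = rat_of_triple (F2 xs)"
    using assms(2) unfolding rat_computable_def by blast
  have l: "length (F1 xs) = 3" "length (F2 xs) = 3" if "length xs = m" for xs
    using F1(1) F2(1) that unfolding tm_computable_def by blast+
  have 6: "tm_computable m 6 (\<lambda>xs. F1 xs @ F2 xs)"
    using tm_computable_append[OF F2(1) F1(1)] by simp
  have "tm_computable 6 3 (\<lambda>ys. map (\<lambda>h. h ys) [s, p, q])"
    using tm_computable_loop[of "[s, p, q]" 6] L by (simp add: numeral_3_eq_3)
  note * = tm_computable_compose[OF 6 this]
  have "q (F1 xs @ F2 xs) \<noteq> 0 \<and> \<rho> xs =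
      rat_of_triple (map (\<lambda>h. h (F1 xs @ F2 xs)) [s, p, q])" if "length xs = m" for xs
    using H[OF that l[OF that]] F1(2)[OF that] F2(2)[OF that] by (simp add: rat_of_triple_def)
  then show ?thesis
    unfolding rat_computable_def using * by (intro exI conjI) auto
qed

lemma representation_uminus: "representation r x \<Longrightarrow> representation (\<lambda>k. - r k) (- x)"
proof -
  assume r: "representation r x"
  then have *: "rat_computable 1 (\<lambda>xs. r (xs ! 0))"
    by (simp add: representation_def computable_rat_seq_iff)
  then have "rat_computable 1 (\<lambda>xs. - r (xs ! 0))"
    by (intro rat_computable_binary[OF * *, where s = "\<lambda>ys. ys ! 0 + 1" and p = "\<lambda>ys. ys ! 1" and q = "\<lambda>ys. ys ! 2"])
      (auto intro!: loop_computable_nth loop_computable_Suc loop_computable_const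
        simp: rat_of_triple_def nth_append)
  moreover have "\<bar>- x - of_rat (- r k)\<bar> \<le> 1 / 2 ^ k" for k
    using r unfolding representation_def of_rat_minus by (metis abs_minus_commute minus_diff_minus abs_minus_cancel)
  ultimately show ?thesis
    by (simp add: representation_def computable_rat_seq_iff)
qed

lemma computable_real_uminus: "computable_real x \<Longrightarrow> computable_real (- x)"
  unfolding computable_real_def using representation_uminus by blast

text \<open>
  Shifting the index by one turns the weak inequality for representations of reals into the
  strict one required of sequences.
\<close>

lemma computable_real_seq_const: 
  assumes "computable_real x"
  shows "computable_real_seq (\<lambda>_. x)"
proof -
  obtain r where r: "rat_computable 1 (\<lambda>xs. r (xs ! 0))" "\<And>k. \<bar>x - of_rat (r k)\<bar> \<le> 1 / 2 ^ k"
    using assms unfolding computable_real_def representation_def computable_rat_seq_iff by blast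
  have "rat_computable 2 (\<lambda>xs. r (xs ! 1 + 1))"
    by (rule rat_computable_reindex[OF r(1), of "[\<lambda>xs. xs ! 1 + 1]"])
      (auto intro!: loop_computable_nth loop_computable_Suc loop_computable_const)
  moreover have "\<bar>x - of_rat (r (k + 1))\<bar> < 1 / 2 ^ k" for k
  proof -
    have "\<bar>x - of_rat (r (k + 1))\<bar> \<le> 1 / 2 ^ (k + 1)" by (rule r(2))
    also have "\<dots> < 1 / 2 ^ k" by (simp add: field_simps)
    finally show ?thesis .
  qed
  ultimately show ?thesis
    unfolding computable_real_seq_def computable_rat_dseq_iff
    by (intro exI[of _ "\<lambda>n k. r (k + 1)"]) auto
qed

lemma recursive_function_add: "recursive_function (\<lambda>k. k + c)"
proof -
  have "\<forall>F\<in>set [\<lambda>xs. xs ! 0 + c]. loop_computable 1 F"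
    by (auto intro: loop_computable_add loop_computable_nth loop_computable_const)
  from tm_computable_loop[OF this] have "tm_computable 1 1 (\<lambda>xs. [xs ! 0 + c])"
    by simp
  then obtain M where M: "tm_wf M" "\<And>xs. length xs = 1 \<Longrightarrow> tm_yields M (map nat_tape xs) [xs ! 0 + c]"
    unfolding tm_computable_def by blast
  show ?thesis
    unfolding recursive_function_def using M(1) M(2)[of "[n]" for n] by auto
qed

lemma loop_computable_step:
  assumes "0 < m"
  shows "loop_computable m (\<lambda>xs. if xs ! 0 < j then 0 else c)"
proof -
  \<comment> \<open>With truncated subtraction, \<open>1 - (j - i)\<close> is 1 for \<open>i \<ge> j\<close> and 0 otherwise.\<close>
  have "(if (i::nat) < j then 0 else c) = (1 - (j - i)) * c" for i by auto
  then show ?thesis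
    using assms by (auto intro!: loop_computable_mult loop_computable_diff loop_computable_const loop_computable_nth)
qed

text \<open>
  A representation of \<open>\<plusminus>1 / 2 ^ j\<close> that starts with \<open>j\<close>
  zeros and so is hard to tell from the representation of 0.
\<close>

definition late_dyadic :: "nat \<Rightarrow> nat \<Rightarrow> nat \<Rightarrow> rat" where
  "late_dyadic s j k = (if k < j then 0 else (- 1) ^ s / 2 ^ j)"

lemma representation_late_dyadic: "representation (late_dyadic s j) ((- 1) ^ s / 2 ^ j)"
proof -
  have "rat_computable 1 (\<lambda>xs. late_dyadic s j (xs ! 0))"
    by (rule rat_computable_loop[where s = "\<lambda>_. s" and p = "\<lambda>xs. if xs ! 0 < j then 0 else 1"
          and q = "\<lambda>_. 2 ^ j"])
      (auto intro: loop_computable_step loop_computable_const simp: late_dyadic_def)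
  moreover have "\<bar>(- 1) ^ s / 2 ^ j - of_rat (late_dyadic s j k)\<bar> \<le> (1::real) / 2 ^ k" for k
    by (auto simp: late_dyadic_def of_rat_divide of_rat_power of_rat_minus power_abs field_simps)
  ultimately show ?thesis
    by (simp add: representation_def computable_rat_seq_iff)
qed

lemma representation_zero: "representation (\<lambda>_. 0) 0"
proof -
  have "rat_computable 1 (\<lambda>xs. 0)"
    by (rule rat_computable_loop[where s = "\<lambda>_. 0" and p = "\<lambda>_. 0" and q = "\<lambda>_. 1"])
      (auto intro: loop_computable_const)
  then show ?thesis by (simp add: representation_def computable_rat_seq_iff)
qed

section \<open>Turing computable functions are locally determined by finite data\<close>

definition agree :: "nat \<Rightarrow> tape \<Rightarrow> tape \<Rightarrow> bool" where
  "agree N t u \<longleftrightarrow> (\<forall>i. \<bar>i\<bar> \<le> int N \<longrightarrow> t i = u i)"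

lemma agree_refl: "agree N t t"
  by (simp add: agree_def)

text \<open>
  A step moves the head by at most one cell, so agreement on a window around the head is lost at
  one cell on either side only.
\<close>

lemma agree_move:
  assumes "agree (Suc N) t u"
  shows "agree N (move_tape m (t(0 := s))) (move_tape m (u(0 := s)))"
proof -
  have *: "t i = u i" if "\<bar>i\<bar> \<le> int N + 1" for i
    using assms that by (simp add: agree_def)
  show ?thesis
    unfolding agree_def by (cases m) (auto intro!: *)
qed

lemma agree_step:
  assumes "list_all2 (agree (Suc N)) ts us"
  shows "fst (tm_step M (q, ts)) = fst (tm_step M (q, us)) \<and>
    list_all2 (agree N) (snd (tm_step M (q, ts))) (snd (tm_step M (q, us)))"
proof (cases "q = tm_final M")
  case True
  have "list_all2 (agree N) ts us"
    using assms by (rule list_all2_mono) (auto simp: agree_def)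
  then show ?thesis using True by simp
next
  case False
  have h: "heads ts = heads us"
    using assms by (auto simp: list_all2_conv_all_nth agree_def intro!: nth_equalityI)
  obtain q' acts where d: "tm_delta M q (heads us) = (q', acts)" by fastforce
  have "list_all2 (agree N) (perform ts acts) (perform us acts)"
    using assms by (auto simp: list_all2_conv_all_nth split_beta intro!: agree_move)
  then show ?thesis using False d h by simp
qed

lemma agree_steps:
  assumes "list_all2 (agree (N + n)) ts us"
  shows "fst ((tm_step M ^^ n) (q, ts)) = fst ((tm_step M ^^ n) (q, us)) \<and>
    list_all2 (agree N) (snd ((tm_step M ^^ n) (q, ts))) (snd ((tm_step M ^^ n) (q, us)))"
  using assms
proof (induction n arbitrary: N)
  case (Suc n)
  have "list_all2 (agree (Suc N + n)) ts us" using Suc.prems by simp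
  note IH = Suc.IH[OF this]
  obtain q1 ts1 us1 where *: "(tm_step M ^^ n) (q, ts) = (q1, ts1)" "(tm_step M ^^ n) (q, us) = (q1, us1)"
    using IH by (metis prod.collapse)
  show ?case
    using agree_step[of N ts1 us1 M q1] IH by (simp add: * del: tm_step.simps)
qed simp

lemma holds_agree:
  assumes "holds t v" "agree N t u" "v \<le> N"
  shows "holds u v"
proof -
  have "t (int j) = u (int j)" if "j \<le> v" for j
    using assms(2,3) that by (simp add: agree_def)
  then show ?thesis using assms(1) by (simp add: holds_def)
qed

text \<open>
  The use principle: a halting run of \<open>n\<close> steps reaches only cells at distance at
  most \<open>n\<close>, and reading off an output needs as many further cells as its value.
\<close>

lemma tm_yields_use:
  assumes "tm_yields M ins outs" "\<forall>t\<in>set ins. unbounded_gaps t"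
  shows "\<exists>N. \<forall>ins'. list_all2 (agree N) ins ins' \<longrightarrow> tm_yields M ins' outs"
proof -
  define pad where "pad ins = ins @ replicate (tm_tapes M - length ins) blank_tape" for ins
  obtain n ts where l: "length ins \<le> tm_tapes M" "length outs \<le> tm_tapes M"
    and n: "(tm_step M ^^ n) (0, pad ins) = (tm_final M, ts)"
    and v: "map tape_value (take (length outs) ts) = outs"
    using assms(1) unfolding tm_yields_def pad_def by blast
  have "\<forall>t\<in>set (pad ins). unbounded_gaps t"
    using assms(2) by (auto simp: pad_def blank_tape_eq unbounded_gaps_nat_tape)
  from unbounded_gaps_steps[OF this, where M = M and n = n and q = 0] have gaps: "\<forall>t\<in>set ts. unbounded_gaps t"
    using n by simp
  have lts: "length outs \<le> length ts"
    using arg_cong[OF v, of length] by simp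
  have holds: "holds (ts ! i) (outs ! i)" if "i < length outs" for i
  proof -
    have "outs ! i = tape_value (ts ! i)"
      using that lts arg_cong[OF v, of "\<lambda>l. l ! i"] by simp
    then show ?thesis using gaps that lts unbounded_gaps_holds by simp
  qed
  have "tm_yields M ins' outs" if "list_all2 (agree (sum_list outs + n)) ins ins'" for ins'
  proof -
    have "length ins = length ins'" using that by (rule list_all2_lengthD)
    then have "list_all2 (agree (sum_list outs + n)) (pad ins) (pad ins')"
      unfolding pad_def using that
      by (intro list_all2_appendI) (auto simp: agree_refl list_all2_conv_all_nth)
    from agree_steps[OF this, where M = M and q = 0] obtain us where
      us: "(tm_step M ^^ n) (0, pad ins') = (tm_final M, us)" "list_all2 (agree (sum_list outs)) ts us"
      using n by (metis fst_conv snd_conv prod.collapse)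
    have "holds (us ! i) (outs ! i)" if "i < length outs" for i
      by (rule holds_agree[OF holds[OF that], of "sum_list outs"])
        (use us(2) that lts elem_le_sum_list[OF that] in \<open>auto simp: list_all2_conv_all_nth\<close>)
    then have "map tape_value (take (length outs) us) = outs"
      using lts us(2) by (intro nth_equalityI) (auto simp: list_all2_conv_all_nth holds_tape_value)
    then show ?thesis
      unfolding tm_yields_def using l us(1) \<open>length ins = length ins'\<close> by (auto simp: pad_def)
  qed
  then show ?thesis by blast
qed

lemma tm_final_steps: "(tm_step M ^^ n) (tm_final M, ts) = (tm_final M, ts)"
  by (induction n) auto

lemma tm_yields_unique:
  assumes "tm_yields M ins outs" "tm_yields M ins outs'" "length outs = length outs'"
  shows "outs = outs'"
proof -
  have uniq: "ts = ts'" if "(tm_step M ^^ n) c = (tm_final M, ts)" "(tm_step M ^^ n') c = (tm_final M, ts')"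
    "n \<le> n'" for n n' c ts ts'
  proof -
    have "(tm_step M ^^ n') c = (tm_step M ^^ (n' - n)) ((tm_step M ^^ n) c)"
      using that(3) by (metis comp_apply funpow_add le_add_diff_inverse2)
    then show ?thesis using that by (simp add: tm_final_steps)
  qed
  show ?thesis
    using assms uniq unfolding tm_yields_def by (metis nle_le)
qed

text \<open>
  Nonempty words contribute at least one letter each, so letter \<open>i\<close> lies in one of
  the words \<open>0, ..., i\<close>.
\<close>

lemma flat_snth_cong:
  assumes "\<forall>w\<in>sset s. w \<noteq> []" "\<forall>w\<in>sset s'. w \<noteq> []" "\<And>k. k \<le> i \<Longrightarrow> s !! k = s' !! k"
  shows "flat s !! i = flat s' !! i"
  using assms
proof (induction i arbitrary: s s' rule: less_induct)
  case (less i)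
  have hd: "shd s = shd s'" using less.prems(3)[of 0] by simp
  show ?case
  proof (cases "i < length (shd s)")
    case True
    then show ?thesis
      using flat_snth[OF less.prems(1), of i] flat_snth[OF less.prems(2), of i] hd by simp
  next
    case False
    have "shd s \<noteq> []" using less.prems(1) shd_sset by blast
    then have "i - length (shd s) < i" using False by (cases "shd s") auto
    moreover have "stl s !! k = stl s' !! k" if "k \<le> i - length (shd s)" for k
      using less.prems(3)[of "Suc k"] that calculation by simp
    moreover have "\<forall>w\<in>sset (stl s). w \<noteq> []" "\<forall>w\<in>sset (stl s'). w \<noteq> []"
      using less.prems(1,2) by (auto dest: stl_sset)
    ultimately have "flat (stl s) !! (i - length (shd s)) = flat (stl s') !! (i - length (shd s))"
      by (intro less.IH)
    then show ?thesis
      using flat_snth[OF less.prems(1), of i] flat_snth[OF less.prems(2), of i] hd False by simp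
  qed
qed

lemma flat_infinitely_often:
  assumes "\<forall>w\<in>sset s. c \<in> set w"
  shows "\<exists>i\<ge>N. flat s !! i = c"
proof -
  have ne: "\<forall>w\<in>sset s. w \<noteq> []" if "\<forall>w\<in>sset s. c \<in> set w" for s
    using that by force
  show ?thesis
    using assms
  proof (induction N arbitrary: s)
    case 0
    then obtain i where "i < length (shd s)" "shd s ! i = c"
      using shd_sset in_set_conv_nth by metis
    then show ?case using flat_snth[OF ne[OF 0], of i] by auto
  next
    case (Suc N)
    have "\<forall>w\<in>sset (stl s). c \<in> set w" using Suc.prems by (auto dest: stl_sset)
    from Suc.IH[OF this] obtain i where i: "i \<ge> N" "flat (stl s) !! i = c" by blast
    have "length (shd s) > 0" using ne[OF Suc.prems] shd_sset by blast
    then show ?case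
      using i flat_snth[OF ne[OF Suc.prems], of "length (shd s) + i"]
      by (intro exI[of _ "length (shd s) + i"] conjI; linarith?) simp
  qed
qed

lemma zero_in_rat_word: "0 \<in> set (rat_word r)"
  by (cases "quotient_of r") (simp add: rat_word_def)

lemma unbounded_gaps_seq_tape: "unbounded_gaps (seq_tape r)"
  unfolding unbounded_gaps_def
proof
  fix N
  obtain i where "i \<ge> nat N" "flat (smap (\<lambda>k. rat_word (r k)) nats) !! i = 0"
    using flat_infinitely_often[of "smap (\<lambda>k. rat_word (r k)) nats" 0] zero_in_rat_word
    by (auto simp: stream.set_map)
  then show "\<exists>i\<ge>N. seq_tape r i \<noteq> 1"
    by (intro exI[of _ "int i"]) (auto simp: seq_tape_def)
qed

lemma agree_seq_tape:
  assumes "\<And>k. k \<le> N \<Longrightarrow> r k = r' k"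
  shows "agree N (seq_tape r) (seq_tape r')"
proof -
  have ne: "rat_word x \<noteq> []" for x using zero_in_rat_word[of x] by auto
  have "flat (smap (\<lambda>k. rat_word (r k)) nats) !! i = flat (smap (\<lambda>k. rat_word (r' k)) nats) !! i"
    if "i \<le> N" for i
    by (rule flat_snth_cong) (use ne assms that in \<open>auto simp: stream.set_map\<close>)
  then show ?thesis
    by (auto simp: agree_def seq_tape_def)
qed

lemma tm_yields_rat_use:
  assumes "tm_yields_rat M [seq_tape r, nat_tape k] y"
  shows "\<exists>N. \<forall>r' y'. (\<forall>i\<le>N. r' i = r i) \<longrightarrow> tm_yields_rat M [seq_tape r', nat_tape k] y' \<longrightarrow> y' = y"
proof -
  obtain s p q where y: "tm_yields M [seq_tape r, nat_tape k] [s, p, q]"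
    "y = (- 1) ^ s * of_nat p / of_nat q"
    using assms unfolding tm_yields_rat_def by blast
  obtain N where N: "\<And>ins'. list_all2 (agree N) [seq_tape r, nat_tape k] ins' \<Longrightarrow> tm_yields M ins' [s, p, q]"
    using tm_yields_use[OF y(1)] by (auto simp: unbounded_gaps_seq_tape unbounded_gaps_nat_tape)
  show ?thesis
  proof (intro exI[of _ N] allI impI)
    fix r' y' assume r': "\<forall>i\<le>N. r' i = r i" and y': "tm_yields_rat M [seq_tape r', nat_tape k] y'"
    have 1: "tm_yields M [seq_tape r', nat_tape k] [s, p, q]"
      by (rule N) (use r' in \<open>auto simp: agree_refl intro!: agree_seq_tape\<close>)
    obtain s' p' q' where 2: "tm_yields M [seq_tape r', nat_tape k] [s', p', q']"
      "y' = (- 1) ^ s' * of_nat p' / of_nat q'"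
      using y' unfolding tm_yields_rat_def by blast
    show "y' = y" using tm_yields_unique[OF 1 2(1)] 2(2) y(2) by simp
  qed
qed

text \<open>
  The number \<open>y\<close> is what the machine produces from the representation of 0 by
  zeros. For large \<open>j\<close> the machine cannot distinguish
  \<open>late_dyadic s j\<close> from that sequence and gives the same answer.
\<close>

lemma turing_computable_at_zero:
  fixes G :: "real \<Rightarrow> real"
  assumes "turing_computable_on D G" "0 \<in> D"
  shows "\<exists>y J. \<forall>j\<ge>J. \<forall>s. (- 1) ^ s / 2 ^ j \<in> D \<longrightarrow> \<bar>G ((- 1) ^ s / 2 ^ j) - y\<bar> \<le> 1 / 2 ^ k"
proof -
  obtain M bs where bs: "distinct bs" "set bs = (Basis :: real set)" and M:
    "\<And>x r. \<lbrakk>x \<in> D; computable_vec x; vec_representation r x\<rbrakk> \<Longrightarrow> \<exists>s. representation s (G x) \<and>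
      (\<forall>k. tm_yields_rat M (map (\<lambda>i. seq_tape (r i)) bs @ [nat_tape k]) (s k))"
    using assms(1) unfolding turing_computable_on_def by blast
  have "bs = [1]"
    using bs by (cases bs; cases "tl bs") (auto simp: Basis_real_def)
  then have run: "\<exists>s. representation s (G x) \<and> tm_yields_rat M [seq_tape r, nat_tape k] (s k)"
    if "x \<in> D" "representation r x" for x r
    using M[OF that(1), of "\<lambda>_. r"] that(2)
    by (auto simp: computable_vec_def vec_representation_def computable_real_def Basis_real_def)
  obtain y where y: "tm_yields_rat M [seq_tape (\<lambda>_. 0), nat_tape k] y"
    using run[OF assms(2) representation_zero] by blast
  obtain N where N: "\<And>r' y'. \<lbrakk>\<forall>i\<le>N. r' i = 0; tm_yields_rat M [seq_tape r', nat_tape k] y'\<rbrakk> \<Longrightarrow> y' = y"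
    using tm_yields_rat_use[OF y] by blast
  show ?thesis
  proof (intro exI allI impI)
    fix j s assume j: "Suc N \<le> j" and D: "(- 1) ^ s / 2 ^ j \<in> D"
    obtain z where z: "representation z (G ((- 1) ^ s / 2 ^ j))"
      "tm_yields_rat M [seq_tape (late_dyadic s j), nat_tape k] (z k)"
      using run[OF D representation_late_dyadic] by blast
    have "z k = y"
      by (rule N[OF _ z(2)]) (use j in \<open>auto simp: late_dyadic_def\<close>)
    then show "\<bar>G ((- 1) ^ s / 2 ^ j) - of_rat y\<bar> \<le> 1 / 2 ^ k"
      using z(1) by (auto simp: representation_def)
  qed
qed

lemma sign_jump_not_turing_computable:
  fixes G :: "real \<Rightarrow> real"
  assumes "b > 0" "\<And>x. 0 < x \<Longrightarrow> x \<le> b \<Longrightarrow> G x = 1" "\<And>x. - b \<le> x \<Longrightarrow> x < 0 \<Longrightarrow> G x = - 1"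
  shows "\<not> turing_computable_on {-b..b} G"
proof
  assume "turing_computable_on {-b..b} G"
  then obtain y J where y: "\<And>j s. j \<ge> J \<Longrightarrow> (- 1) ^ s / 2 ^ j \<in> {-b..b} \<Longrightarrow>
      \<bar>G ((- 1) ^ s / 2 ^ j) - y\<bar> \<le> 1 / 2 ^ 1"
    using turing_computable_at_zero[of "{-b..b}" G 1] assms(1) by auto
  obtain i where i: "(1 / 2) ^ i < b"
    using reals_power_lt_ex[OF assms(1), of 2] by auto
  define j where "j = max i J"
  have "1 / 2 ^ j \<le> 1 / (2::real) ^ i" by (simp add: j_def field_simps)
  then have j: "1 / 2 ^ j \<le> b" using i by (simp add: power_one_over)
  have p: "0 < 1 / (2::real) ^ j" by simp
  have "G (1 / 2 ^ j) = 1" "G (- 1 / 2 ^ j) = - 1"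
    using assms(2)[of "1 / 2 ^ j"] assms(3)[of "- 1 / 2 ^ j"] j p by simp_all
  moreover have "1 / 2 ^ j \<in> {-b..b}" "- 1 / 2 ^ j \<in> {-b..b}"
    using j p assms(1) unfolding atLeastAtMost_iff by linarith+
  ultimately have "\<bar>1 - y\<bar> \<le> 1 / 2" "\<bar>- 1 - y\<bar> \<le> 1 / 2"
    using y[of j 0] y[of j 1] by (simp_all add: j_def)
  then show False by linarith
qed

section \<open>Computable continuity on rectangles\<close>

lemma computable_vec_real: "computable_vec (x::real) \<longleftrightarrow> computable_real x"
  by (simp add: computable_vec_def)

lemma computable_vec_Pair:
  "computable_vec (x::real, y::real) \<longleftrightarrow> computable_real x \<and> computable_real y"
  by (auto simp: computable_vec_def Basis_prod_def)

lemma computable_vec_seq_real: "computable_vec_seq (x :: nat \<Rightarrow> real) \<longleftrightarrow> computable_real_seq x"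
  by (simp add: computable_vec_seq_def)

lemma computable_vec_seq_Pair:
  "computable_vec_seq (x :: nat \<Rightarrow> real \<times> real) \<longleftrightarrow>
     computable_real_seq (\<lambda>n. fst (x n)) \<and> computable_real_seq (\<lambda>n. snd (x n))"
  by (auto simp: computable_vec_seq_def Basis_prod_def inner_prod_def)

lemma computable_rectangle_symmetric_interval:
  assumes "computable_real a" "0 \<le> a"
  shows "computable_rectangle {-a..a}"
  unfolding computable_rectangle_def
  using assms computable_real_uminus[OF assms(1)]
  by (intro exI[of _ "-a"] exI[of _ a]) (auto simp: computable_vec_real)

lemma computable_rectangle_symmetric_product:
  assumes "computable_real a" "0 \<le> a" "computable_real b" "0 \<le> b"
  shows "computable_rectangle ({-a..a} \<times> {-b..b})"
  unfolding computable_rectangle_def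
  using assms computable_real_uminus[OF assms(1)] computable_real_uminus[OF assms(3)]
  by (intro exI[of _ "(-a, -b)"] exI[of _ "(a, b)"])
    (auto simp: computable_vec_Pair cbox_Pair_eq Basis_prod_def)

text \<open>
  Used for the sections of a function of two variables, where \<open>e\<close> adds a fixed
  computable coordinate.
\<close>

lemma computable_continuous_on_isometric_pullback:
  fixes f :: "'b::euclidean_space \<Rightarrow> real" and e :: "'a::euclidean_space \<Rightarrow> 'b"
  assumes f: "computable_continuous_on D f" and "computable_rectangle S"
    and into: "\<And>x. x \<in> S \<Longrightarrow> e x \<in> D" and iso: "\<And>x y. norm (e x - e y) = norm (x - y)"
    and seq: "\<And>x. computable_vec_seq x \<Longrightarrow> computable_vec_seq (\<lambda>n. e (x n))"
  shows "computable_continuous_on S (\<lambda>x. f (e x))"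
  unfolding computable_continuous_on_def
proof (intro conjI)
  show "banach_mazur_computable_on S (\<lambda>x. f (e x))"
    using f into seq unfolding computable_continuous_on_def banach_mazur_computable_on_def by blast
  obtain d where d: "recursive_function d"
    "\<And>k p q. \<lbrakk>p \<in> D; q \<in> D; norm (p - q) \<le> 1 / 2 ^ d k\<rbrakk> \<Longrightarrow> \<bar>f p - f q\<bar> \<le> 1 / 2 ^ k"
    using f unfolding computable_continuous_on_def effectively_uniformly_continuous_on_def by blast
  show "effectively_uniformly_continuous_on S (\<lambda>x. f (e x))"
    unfolding effectively_uniformly_continuous_on_def
    using d(1) by (intro exI[of _ d] conjI allI ballI impI d(2)) (auto simp: into iso)
qed (rule assms(2))

section \<open>The tilted trough\<close>

text \<open>
  Defined over an arbitrary ordered field, so that one formula serves as the real function and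
  as the rational function that machines evaluate.
\<close>

definition trough :: "nat \<Rightarrow> 'a::linordered_field \<Rightarrow> 'a \<Rightarrow> 'a" where
  "trough N x y = max 0 (\<bar>x\<bar> - 1) + \<bar>y\<bar> - x * y / of_nat N"

lemma of_rat_trough: "of_rat (trough N u v) = (trough N (of_rat u) (of_rat v) :: real)"
proof -
  have "of_rat \<bar>w\<bar> = (\<bar>of_rat w\<bar> :: real)" for w
    by (auto simp: abs_if of_rat_minus)
  moreover have "of_rat (max 0 w) = (max 0 (of_rat w) :: real)" for w
    by (auto simp: max_def)
  ultimately show ?thesis
    by (simp add: trough_def of_rat_add of_rat_diff of_rat_mult of_rat_divide)
qed

text \<open>
  Over the common denominator \<open>N q q'\<close> everything is natural number arithmetic:
  truncated subtraction \<open>p - q\<close> is the numerator of \<open>max 0 (|u| - 1)\<close>,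
  and the sign of the product is the parity of \<open>s + s'\<close>. For
  \<open>|u| \<le> N\<close> the value is nonnegative, as \<open>u v / N\<close> cannot exceed
  \<open>|v|\<close>; hence the outer subtraction is not truncated and the sign of the result is
  always 0.
\<close>

lemma trough_fraction:
  fixes u v :: rat
  assumes u: "u = (- 1) ^ s * of_nat p / of_nat q" "\<bar>u\<bar> \<le> of_nat N" "q \<noteq> 0"
    and v: "v = (- 1) ^ s' * of_nat p' / of_nat q'" "q' \<noteq> 0" and "N \<noteq> 0"
  defines "A \<equiv> (p - q) * (N * q') + p' * (N * q)"
  shows "trough N u v =
    of_nat (A + (s + s') mod 2 * (p * p') - (1 - (s + s') mod 2) * (p * p')) / of_nat (N * (q * q'))"
proof -
  have au: "\<bar>u\<bar> = of_nat p / of_nat q" and av: "\<bar>v\<bar> = of_nat p' / of_nat q'"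
    unfolding u(1) v(1) by (simp_all add: abs_mult power_abs)
  have m: "max 0 (\<bar>u\<bar> - 1) = of_nat (p - q) / of_nat q"
    unfolding au using u(3) by (cases "p \<le> q") (auto simp: of_nat_diff field_simps max_def)
  have uv: "u * v = (- 1) ^ (s + s') * of_nat (p * p') / of_nat (q * q')"
    unfolding u(1) v(1) by (simp add: power_add)
  \<comment> \<open>The value without the bilinear term.\<close>
  have A: "of_nat (p - q) / of_nat q + of_nat p' / of_nat q' = (of_nat A / of_nat (N * (q * q')) :: rat)"
    using assms(3,5,6) by (simp add: A_def field_simps)
  have "(of_nat p :: rat) \<le> of_nat (N * q)"
    using u(2,3) unfolding au by (simp add: field_simps)
  then have "p \<le> N * q" by (simp only: of_nat_le_iff)
  then have "p * p' \<le> N * q * p'" by (rule mult_le_mono1)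
  also have "\<dots> \<le> A" by (simp add: A_def)
  finally have B: "p * p' \<le> A" .
  show ?thesis
  proof (cases "even (s + s')")
    case True
    then have "(s + s') mod 2 = 0" "(- 1 :: rat) ^ (s + s') = 1"
      by (simp_all only: even_iff_mod_2_eq_zero neg_one_even_power)
    then show ?thesis
      unfolding trough_def m av uv A using B by (simp add: of_nat_diff diff_divide_distrib)
  next
    case False
    then have "(s + s') mod 2 = 1" "(- 1 :: rat) ^ (s + s') = - 1"
      by (simp_all only: odd_iff_mod_2_eq_one neg_one_odd_power)
    then show ?thesis
      unfolding trough_def m av uv A by (simp add: add_divide_distrib)
  qed
qed

lemma rat_computable_trough:
  assumes "rat_computable m \<rho>1" "rat_computable m \<rho>2" "N \<noteq> 0"
    and bd: "\<And>xs. length xs = m \<Longrightarrow> \<bar>\<rho>1 xs\<bar> \<le> of_nat N"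
  shows "rat_computable m (\<lambda>xs. trough N (\<rho>1 xs) (\<rho>2 xs))"
proof (rule rat_computable_binary[OF assms(1,2), where s = "\<lambda>_. 0"
      and p = "\<lambda>v. (v ! 1 - v ! 2) * (N * v ! 5) + v ! 4 * (N * v ! 2)
        + (v ! 0 + v ! 3) mod 2 * (v ! 1 * v ! 4) - (1 - (v ! 0 + v ! 3) mod 2) * (v ! 1 * v ! 4)"
      and q = "\<lambda>v. N * (v ! 2 * v ! 5)"])
  have i: "loop_computable 6 (\<lambda>v. v ! i)" if "i < 6" for i
    using that by (rule loop_computable_nth)
  note intro = loop_computable_add loop_computable_diff loop_computable_mult loop_computable_parity
    loop_computable_const
  have "loop_computable 6 (\<lambda>v. (v ! 1 - v ! 2) * (N * v ! 5) + v ! 4 * (N * v ! 2)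
        + (v ! 0 + v ! 3) mod 2 * (v ! 1 * v ! 4) - (1 - (v ! 0 + v ! 3) mod 2) * (v ! 1 * v ! 4))"
    "loop_computable 6 (\<lambda>v. N * (v ! 2 * v ! 5))" "loop_computable 6 (\<lambda>v. 0)"
    by (intro intro i; simp)+
  then show "\<forall>h\<in>{\<lambda>_. 0,
      \<lambda>v. (v ! 1 - v ! 2) * (N * v ! 5) + v ! 4 * (N * v ! 2)
        + (v ! 0 + v ! 3) mod 2 * (v ! 1 * v ! 4) - (1 - (v ! 0 + v ! 3) mod 2) * (v ! 1 * v ! 4),
      \<lambda>v. N * (v ! 2 * v ! 5)}. loop_computable 6 h"
    by blast
next
  fix xs ys zs :: "nat list"
  assume *: "length xs = m" "length ys = 3" "length zs = 3" "ys ! 2 \<noteq> 0" "zs ! 2 \<noteq> 0"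
    "\<rho>1 xs = rat_of_triple ys" "\<rho>2 xs = rat_of_triple zs"
  let ?v = "ys @ zs"
  have v: "?v ! 0 = ys ! 0" "?v ! 1 = ys ! 1" "?v ! 2 = ys ! 2" "?v ! 3 = zs ! 0" "?v ! 4 = zs ! 1" "?v ! 5 = zs ! 2"
    using * by (simp_all add: nth_append)
  show "N * (?v ! 2 * ?v ! 5) \<noteq> 0 \<and> trough N (\<rho>1 xs) (\<rho>2 xs) = (- 1) ^ 0 *
      of_nat ((?v ! 1 - ?v ! 2) * (N * ?v ! 5) + ?v ! 4 * (N * ?v ! 2)
        + (?v ! 0 + ?v ! 3) mod 2 * (?v ! 1 * ?v ! 4) - (1 - (?v ! 0 + ?v ! 3) mod 2) * (?v ! 1 * ?v ! 4))
      / of_nat (N * (?v ! 2 * ?v ! 5))"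
    unfolding v
    using trough_fraction[OF *(6)[unfolded rat_of_triple_def] bd[OF *(1)] *(4)
        *(7)[unfolded rat_of_triple_def] *(5) assms(3)] *(4,5) assms(3)
    by simp
qed

text \<open>
  The factors \<open>y\<close> and \<open>x'\<close> left over when the difference of the two
  products is split are absorbed by the denominator \<open>N\<close>.
\<close>

lemma trough_lipschitz:
  fixes x y x' y' :: real
  assumes "0 < N" "\<bar>y\<bar> \<le> real N" "\<bar>x'\<bar> \<le> real N"
  shows "\<bar>trough N x y - trough N x' y'\<bar> \<le> 2 * (\<bar>x - x'\<bar> + \<bar>y - y'\<bar>)"
proof -
  have "x * y - x' * y' = (x - x') * y + x' * (y - y')" by (simp add: algebra_simps)
  then have "\<bar>x * y - x' * y'\<bar> \<le> \<bar>x - x'\<bar> * \<bar>y\<bar> + \<bar>x'\<bar> * \<bar>y - y'\<bar>"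
    by (metis abs_triangle_ineq abs_mult)
  also have "\<dots> \<le> \<bar>x - x'\<bar> * real N + real N * \<bar>y - y'\<bar>"
    using assms by (intro add_mono mult_mono) auto
  also have "\<dots> = real N * (\<bar>x - x'\<bar> + \<bar>y - y'\<bar>)" by (simp add: algebra_simps)
  finally have 1: "\<bar>x * y / real N - x' * y' / real N\<bar> \<le> \<bar>x - x'\<bar> + \<bar>y - y'\<bar>"
    using assms(1) by (simp add: field_simps flip: diff_divide_distrib)
  have 2: "\<bar>max 0 (\<bar>x\<bar> - 1) - max 0 (\<bar>x'\<bar> - 1)\<bar> \<le> \<bar>x - x'\<bar>" by linarith
  have 3: "\<bar>\<bar>y\<bar> - \<bar>y'\<bar>\<bar> \<le> \<bar>y - y'\<bar>" by (rule abs_triangle_ineq3)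
  have sum: "\<bar>u + v - w\<bar> \<le> \<bar>u\<bar> + \<bar>v\<bar> + \<bar>w\<bar>" for u v w :: real by linarith
  have "trough N x y - trough N x' y' = (max 0 (\<bar>x\<bar> - 1) - max 0 (\<bar>x'\<bar> - 1)) + (\<bar>y\<bar> - \<bar>y'\<bar>)
      - (x * y / real N - x' * y' / real N)"
    by (simp add: trough_def)
  also have "\<bar>\<dots>\<bar> \<le> \<bar>x - x'\<bar> + \<bar>y - y'\<bar> + (\<bar>x - x'\<bar> + \<bar>y - y'\<bar>)"
    by (rule order_trans[OF sum add_mono[OF add_mono[OF 2 3] 1]])
  finally show ?thesis by simp
qed

lemma computable_real_seq_trough:
  assumes "computable_real_seq x" "computable_real_seq y"
    and "\<And>n. \<bar>x n\<bar> + 1 \<le> real N" "\<And>n. \<bar>y n\<bar> \<le> real N"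
  shows "computable_real_seq (\<lambda>n. trough N (x n) (y n))"
proof -
  obtain r where r: "rat_computable 2 (\<lambda>xs. r (xs ! 0) (xs ! 1))" "\<And>n k. \<bar>x n - of_rat (r n k)\<bar> < 1 / 2 ^ k"
    using assms(1) unfolding computable_real_seq_def computable_rat_dseq_iff by blast
  obtain s where s: "rat_computable 2 (\<lambda>xs. s (xs ! 0) (xs ! 1))" "\<And>n k. \<bar>y n - of_rat (s n k)\<bar> < 1 / 2 ^ k"
    using assms(2) unfolding computable_real_seq_def computable_rat_dseq_iff by blast
  define t where "t n k = trough N (r n (k + 2)) (s n (k + 2))" for n k
  have N: "0 < N" using assms(3)[of 0] by (cases N) auto
  \<comment> \<open>The slack of 1 in the bound on \<open>x n\<close> covers the error of its approximations.\<close>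
  have bd: "\<bar>of_rat (r n k)\<bar> \<le> real N" for n k
  proof -
    have "(1::real) / 2 ^ k \<le> 1" by simp
    then show ?thesis using r(2)[of n k] assms(3)[of n] by linarith
  qed
  have bd': "\<bar>r n k\<bar> \<le> of_nat N" for n k
  proof -
    have "real_of_rat \<bar>r n k\<bar> \<le> of_rat (of_nat N)" using bd[of n k] by (auto simp: abs_if of_rat_minus split: if_splits)
    then show ?thesis by (simp only: of_rat_less_eq)
  qed
  have shift: "rat_computable 2 (\<lambda>xs. u (xs ! 0) (xs ! 1 + 2))"
    if "rat_computable 2 (\<lambda>xs. u (xs ! 0) (xs ! 1))" for u
    by (rule rat_computable_reindex[OF that, of "[\<lambda>xs. xs ! 0, \<lambda>xs. xs ! 1 + 2]"])
      (auto intro!: loop_computable_nth loop_computable_Suc)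
  have "rat_computable 2 (\<lambda>xs. t (xs ! 0) (xs ! 1))"
    unfolding t_def using rat_computable_trough[OF shift[OF r(1)] shift[OF s(1)]] N bd' by simp
  moreover have "\<bar>trough N (x n) (y n) - of_rat (t n k)\<bar> < 1 / 2 ^ k" for n k
  proof -
    have "\<bar>trough N (x n) (y n) - of_rat (t n k)\<bar> \<le>
        2 * (\<bar>x n - of_rat (r n (k + 2))\<bar> + \<bar>y n - of_rat (s n (k + 2))\<bar>)"
      unfolding t_def of_rat_trough by (rule trough_lipschitz[OF N assms(4) bd])
    also have "\<dots> < 2 * (1 / 2 ^ (k + 2) + 1 / 2 ^ (k + 2))"
      using r(2)[of n "k + 2"] s(2)[of n "k + 2"] by simp
    also have "\<dots> = 1 / 2 ^ k" by (simp add: field_simps)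
    finally show ?thesis .
  qed
  ultimately show ?thesis
    unfolding computable_real_seq_def computable_rat_dseq_iff by blast
qed

lemma computable_continuous_trough:
  assumes "computable_real a" "computable_real b" "0 \<le> a" "0 \<le> b" "a + 1 \<le> real N" "b \<le> real N"
  shows "computable_continuous_on ({-a..a} \<times> {-b..b}) (\<lambda>(x, y). trough N x y)"
  unfolding computable_continuous_on_def
proof (intro conjI)
  show "computable_rectangle ({-a..a} \<times> {-b..b})"
    using assms by (intro computable_rectangle_symmetric_product) auto
  show "banach_mazur_computable_on ({-a..a} \<times> {-b..b}) (\<lambda>(x, y). trough N x y)"
    unfolding banach_mazur_computable_on_def
  proof (intro allI impI)
    fix p :: "nat \<Rightarrow> real \<times> real"
    assume p: "computable_vec_seq p" "\<forall>n. p n \<in> {-a..a} \<times> {-b..b}"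
    have bd: "- a \<le> fst (p n)" "fst (p n) \<le> a" "- b \<le> snd (p n)" "snd (p n) \<le> b" for n
      using p(2)[rule_format, of n] by (auto simp: mem_Times_iff)
    have "computable_real_seq (\<lambda>n. trough N (fst (p n)) (snd (p n)))"
    proof (rule computable_real_seq_trough)
      fix n
      show "\<bar>fst (p n)\<bar> + 1 \<le> real N" "\<bar>snd (p n)\<bar> \<le> real N"
        using bd[of n] assms(5,6) by linarith+
    qed (use p(1) in \<open>auto simp: computable_vec_seq_Pair\<close>)
    then show "computable_real_seq (\<lambda>n. case p n of (x, y) \<Rightarrow> trough N x y)"
      by (simp add: split_beta)
  qed
  show "effectively_uniformly_continuous_on ({-a..a} \<times> {-b..b}) (\<lambda>(x, y). trough N x y)"
    unfolding effectively_uniformly_continuous_on_def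
  proof (intro exI[of _ "\<lambda>k. k + 2"] conjI recursive_function_add allI ballI impI)
    fix k and p q :: "real \<times> real"
    assume "p \<in> {-a..a} \<times> {-b..b}" "q \<in> {-a..a} \<times> {-b..b}" and le: "norm (p - q) \<le> 1 / 2 ^ (k + 2)"
    then have "\<bar>snd p\<bar> \<le> real N" "\<bar>fst q\<bar> \<le> real N" "0 < N"
      using assms(3,5,6) by (auto simp: mem_Times_iff intro: Nat.gr0I)
    then have "\<bar>trough N (fst p) (snd p) - trough N (fst q) (snd q)\<bar> \<le>
        2 * (\<bar>fst p - fst q\<bar> + \<bar>snd p - snd q\<bar>)"
      by (intro trough_lipschitz)
    also have "\<dots> \<le> 2 * (1 / 2 ^ (k + 2) + 1 / 2 ^ (k + 2))"
    proof -
      have "\<bar>fst p - fst q\<bar> \<le> norm (p - q)" "\<bar>snd p - snd q\<bar> \<le> norm (p - q)"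
        by (metis fst_diff norm_fst_le prod.collapse real_norm_def,
            metis snd_diff norm_snd_le prod.collapse real_norm_def)
      from this[THEN order_trans, OF le] show ?thesis
        by (intro mult_left_mono add_mono) simp_all
    qed
    also have "\<dots> = 1 / 2 ^ k" by (simp add: field_simps)
    finally show "\<bar>(case p of (x, y) \<Rightarrow> trough N x y) - (case q of (x, y) \<Rightarrow> trough N x y)\<bar> \<le> 1 / 2 ^ k"
      by (simp add: split_beta)
  qed
qed

lemma convex_on_max_abs: "convex_on UNIV (\<lambda>x::real. max 0 (\<bar>x\<bar> - 1))"
proof (rule convex_onI)
  fix t x y :: real assume t: "0 < t" "t < 1"
  have "\<bar>(1 - t) * x + t * y\<bar> \<le> \<bar>(1 - t) * x\<bar> + \<bar>t * y\<bar>" by (rule abs_triangle_ineq)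
  also have "\<dots> = (1 - t) * \<bar>x\<bar> + t * \<bar>y\<bar>" using t by (simp add: abs_mult)
  also have "\<dots> - 1 = (1 - t) * (\<bar>x\<bar> - 1) + t * (\<bar>y\<bar> - 1)" by (simp add: algebra_simps)
  also have "\<dots> \<le> (1 - t) * max 0 (\<bar>x\<bar> - 1) + t * max 0 (\<bar>y\<bar> - 1)"
    using t by (intro add_mono mult_left_mono) auto
  finally have "\<bar>(1 - t) * x + t * y\<bar> - 1 \<le> (1 - t) * max 0 (\<bar>x\<bar> - 1) + t * max 0 (\<bar>y\<bar> - 1)"
    by linarith
  moreover have "0 \<le> (1 - t) * max 0 (\<bar>x\<bar> - 1) + t * max 0 (\<bar>y\<bar> - 1)"
    using t by (intro add_nonneg_nonneg mult_nonneg_nonneg) auto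
  ultimately show "max 0 (\<bar>(1 - t) *\<^sub>R x + t *\<^sub>R y\<bar> - 1) \<le>
      (1 - t) * max 0 (\<bar>x\<bar> - 1) + t * max 0 (\<bar>y\<bar> - 1)"
    by simp
qed auto

lemma convex_on_abs: "convex_on UNIV (\<lambda>x::real. \<bar>x\<bar>)"
  using convex_on_dist[of UNIV "0::real"] by (simp add: dist_real_def)

lemma convex_on_linear_plus: "convex_on UNIV (\<lambda>x::real. m * x + c)"
  by (rule convex_onI) (auto simp: algebra_simps)

lemma convex_on_trough:
  "convex_on {-a..a} (\<lambda>x::real. trough N x y)" "convex_on {-b..b} (\<lambda>y::real. trough N x y)"
proof -
  have "convex_on UNIV (\<lambda>x::real. max 0 (\<bar>x\<bar> - 1) + (- y / real N * x + \<bar>y\<bar>))"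
    by (intro convex_on_add convex_on_max_abs convex_on_linear_plus)
  also have "(\<lambda>x. max 0 (\<bar>x\<bar> - 1) + (- y / real N * x + \<bar>y\<bar>)) = (\<lambda>x. trough N x y)"
    by (simp add: trough_def fun_eq_iff)
  finally show "convex_on {-a..a} (\<lambda>x::real. trough N x y)"
    by (rule convex_on_subset) auto
next
  have "convex_on UNIV (\<lambda>y::real. \<bar>y\<bar> + (- x / real N * y + max 0 (\<bar>x\<bar> - 1)))"
    by (intro convex_on_add convex_on_abs convex_on_linear_plus)
  also have "(\<lambda>y. \<bar>y\<bar> + (- x / real N * y + max 0 (\<bar>x\<bar> - 1))) = (\<lambda>y. trough N x y)"
    by (simp add: trough_def fun_eq_iff)
  finally show "convex_on {-b..b} (\<lambda>y::real. trough N x y)"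
    by (rule convex_on_subset) auto
qed

lemma piecewise_linear_trough_fst:
  assumes "1 < a"
  shows "piecewise_linear_on (-a) a 3 (\<lambda>x. trough N x y)"
  unfolding piecewise_linear_on_def
  using assms
  by (intro exI[of _ "\<lambda>i. [-a, -1, 1, a] ! i"] exI[of _ "\<lambda>i. [-1 - y / N, - y / N, 1 - y / N] ! i"]
      exI[of _ "\<lambda>i. [\<bar>y\<bar> - 1, \<bar>y\<bar>, \<bar>y\<bar> - 1] ! i"])
    (auto simp: numeral_3_eq_3 less_Suc_eq trough_def algebra_simps)

lemma piecewise_linear_trough_snd:
  assumes "0 < b"
  shows "piecewise_linear_on (-b) b 2 (\<lambda>y. trough N x y)"
  unfolding piecewise_linear_on_def
  using assms
  by (intro exI[of _ "\<lambda>i. [-b, 0, b] ! i"] exI[of _ "\<lambda>i. [-1 - x / N, 1 - x / N] ! i"]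
      exI[of _ "\<lambda>i. max 0 (\<bar>x\<bar> - 1)"])
    (auto simp: numeral_2_eq_2 less_Suc_eq trough_def algebra_simps)

lemma trough_uminus: "trough N (- x) (- y) = trough N x y"
  by (simp add: trough_def)

text \<open>
  Left of 1 the tilt makes the function decrease, right of 1 the wall of slope 1 outweighs the
  tilt.
\<close>

lemma trough_fst_minimum:
  fixes x y :: real
  assumes "0 < y" "y < real N" "x \<noteq> 1"
  shows "trough N 1 y < trough N x y"
proof -
  have N: "0 < real N" using assms by linarith
  have eq: "trough N x y - trough N 1 y = max 0 (\<bar>x\<bar> - 1) + (1 - x) * (y / real N)"
    by (simp add: trough_def algebra_simps diff_divide_distrib)
  have "0 < y / real N" "y / real N < 1" using assms N by simp_all
  show ?thesis
  proof (cases "x < 1")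
    case True
    then have "0 < (1 - x) * (y / real N)" using \<open>0 < y / real N\<close>
      by (intro mult_pos_pos) auto
    then show ?thesis using eq by linarith
  next
    case False
    then have "0 < (x - 1) * (1 - y / real N)" using assms(3) \<open>y / real N < 1\<close>
      by (intro mult_pos_pos) auto
    moreover have "max 0 (\<bar>x\<bar> - 1) + (1 - x) * r = (x - 1) * (1 - r)" for r
      using False by (simp add: algebra_simps)
    note this[of "y / real N"]
    ultimately show ?thesis using eq by linarith
  qed
qed

lemma global_minimizers_trough_fst:
  fixes y :: real
  assumes "1 < a" "\<bar>y\<bar> < real N" "y \<noteq> 0"
  shows "global_minimizers {-a..a} (\<lambda>x. trough N x y) = {sgn y}"
proof -
  have s: "sgn y \<in> {-a..a}" using assms(1,3) by (auto simp: sgn_if)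
  have lt: "trough N (sgn y) y < trough N x y" if "x \<noteq> sgn y" for x
  proof (cases "0 < y")
    case True
    then show ?thesis using trough_fst_minimum[of y N x] assms that by simp
  next
    case False
    then have "trough N 1 (- y) < trough N (- x) (- y)"
      using trough_fst_minimum[of "- y" N "- x"] assms that by auto
    then show ?thesis using False assms trough_uminus[of N "-1" y] trough_uminus[of N x y] by simp
  qed
  show ?thesis
    unfolding global_minimizers_def is_arg_min_def
  proof (intro set_eqI iffI)
    fix x assume "x \<in> {x. x \<in> {-a..a} \<and> \<not> (\<exists>x'. x' \<in> {-a..a} \<and> trough N x' y < trough N x y)}"
    then have "\<not> trough N (sgn y) y < trough N x y" using s by blast
    then show "x \<in> {sgn y}" using lt by blast
  next
    fix x assume "x \<in> {sgn y}"
    then have x: "x = sgn y" by simp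
    then have "\<not> trough N x' y < trough N x y" for x'
      using lt[of x'] by (cases "x' = sgn y") auto
    then show "x \<in> {x. x \<in> {-a..a} \<and> \<not> (\<exists>x'. x' \<in> {-a..a} \<and> trough N x' y < trough N x y)}"
      using s x by blast
  qed
qed

text \<open>
  This is the coefficient of \<open>s\<close> in \<open>trough N x (s * y)\<close> for
  \<open>s \<ge> 0\<close>; its positivity makes the function increase along every vertical ray
  leaving \<open>y = 0\<close>.
\<close>

lemma trough_snd_slope_pos:
  fixes x y :: real
  assumes "\<bar>x\<bar> < real N" "y \<noteq> 0"
  shows "0 < \<bar>y\<bar> - x * y / real N"
proof -
  have "x * y \<le> \<bar>x\<bar> * \<bar>y\<bar>" by (metis abs_ge_self abs_mult)
  also have "\<dots> < real N * \<bar>y\<bar>" using assms by simp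
  finally show ?thesis using assms(1) by (simp add: field_simps)
qed

lemma global_minimizers_trough:
  assumes "1 < a" "0 < b" "a < real N"
  shows "global_minimizers ({-a..a} \<times> {-b..b}) (\<lambda>(x, y). trough N x y) = {-1..1} \<times> {0}"
proof -
  have z: "trough N x 0 = 0" if "x \<in> {-1..1}" for x :: real
  proof -
    have "\<bar>x\<bar> \<le> 1" using that by auto
    then show ?thesis by (simp add: trough_def)
  qed
  have pos: "0 < trough N x y" if "x \<in> {-a..a}" "y \<noteq> 0 \<or> x \<notin> {-1..1}" for x y :: real
  proof (cases "y = 0")
    case False
    have "0 < \<bar>y\<bar> - x * y / real N"
      by (rule trough_snd_slope_pos) (use that(1) assms False in auto)
    then show ?thesis unfolding trough_def by linarith
  next
    case True
    then show ?thesis using that by (auto simp: trough_def max_def)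
  qed
  have nonneg: "0 \<le> trough N x y" if "x \<in> {-a..a}" for x y :: real
    using pos[OF that, of y] z[of x] by (cases "y = 0 \<and> x \<in> {-1..1}") auto
  have "(0, 0) \<in> {-a..a} \<times> {-b..b}" using assms by simp
  show ?thesis
    unfolding global_minimizers_def is_arg_min_def
  proof (intro set_eqI iffI)
    fix p assume "p \<in> {p. p \<in> {-a..a} \<times> {-b..b} \<and> \<not> (\<exists>q. q \<in> {-a..a} \<times> {-b..b} \<and>
        (case q of (x, y) \<Rightarrow> trough N x y) < (case p of (x, y) \<Rightarrow> trough N x y))}"
    then have "fst p \<in> {-a..a}" "\<not> trough N 0 0 < trough N (fst p) (snd p)"
      using \<open>(0, 0) \<in> _\<close> by (auto simp: split_beta)
    then show "p \<in> {-1..1} \<times> {0}"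
      using pos[of "fst p" "snd p"] z[of 0] by (auto simp: mem_Times_iff)
  next
    fix p :: "real \<times> real" assume "p \<in> {-1..1} \<times> {0}"
    then have "p \<in> {-a..a} \<times> {-b..b}" "trough N (fst p) (snd p) = 0"
      using assms z[of "fst p"] by auto
    then have P: "p \<in> {-a..a} \<times> {-b..b}" "(case p of (x, y) \<Rightarrow> trough N x y) = 0"
      by (simp_all add: split_beta)
    have "0 \<le> (case q of (x, y) \<Rightarrow> trough N x y)" if "q \<in> {-a..a} \<times> {-b..b}" for q
      using nonneg[of "fst q" "snd q"] that by (auto simp: split_beta)
    then show "p \<in> {p. p \<in> {-a..a} \<times> {-b..b} \<and> \<not> (\<exists>q. q \<in> {-a..a} \<times> {-b..b} \<and>
        (case q of (x, y) \<Rightarrow> trough N x y) < (case p of (x, y) \<Rightarrow> trough N x y))}"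
      unfolding mem_Collect_eq P(2) using P(1) by (meson linorder_not_le)
  qed
qed

text \<open>
  Shrinking \<open>y\<close> towards 0 lowers the value as long as \<open>y \<noteq> 0\<close>;
  on \<open>y = 0\<close>, shrinking \<open>x\<close> does as long as \<open>|x| > 1\<close>.
  Both moves can be made arbitrarily small and stay in the rectangle.
\<close>

lemma local_minimizers_trough:
  assumes "1 < a" "0 < b" "a < real N"
  shows "local_minimizers ({-a..a} \<times> {-b..b}) (\<lambda>(x, y). trough N x y) \<subseteq> {-1..1} \<times> {0}"
proof clarify
  fix x y assume "(x, y) \<in> local_minimizers ({-a..a} \<times> {-b..b}) (\<lambda>(x, y). trough N x y)"
  then obtain e where "0 < e" and xy: "x \<in> {-a..a}" "y \<in> {-b..b}" and
    e: "\<And>x' y'. \<lbrakk>x' \<in> {-a..a}; y' \<in> {-b..b}; dist (x, y) (x', y') < e\<rbrakk> \<Longrightarrow> trough N x y \<le> trough N x' y'"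
    unfolding local_minimizers_def is_arg_min_def by (fastforce simp: not_less)
  \<comment> \<open>Both moves below, of length \<open>t |x|\<close> and \<open>t |y|\<close>, stay within distance \<open>e\<close>.\<close>
  define t where "t = min (1/2) (e / (2 * (\<bar>x\<bar> + \<bar>y\<bar> + 1)))"
  have "t \<le> 1/2" unfolding t_def by (rule min.cobounded1)
  moreover have "0 < t" using \<open>0 < e\<close> by (auto simp: t_def intro: divide_pos_pos)
  ultimately have t: "0 < t" "t \<le> 1/2" by simp_all
  have "t * (\<bar>x\<bar> + \<bar>y\<bar> + 1) \<le> e / 2"
  proof -
    have "t \<le> e / (2 * (\<bar>x\<bar> + \<bar>y\<bar> + 1))" by (simp add: t_def)
    then show ?thesis by (simp add: field_simps)
  qed
  moreover have "t * \<bar>x\<bar> \<le> t * (\<bar>x\<bar> + \<bar>y\<bar> + 1)" "t * \<bar>y\<bar> \<le> t * (\<bar>x\<bar> + \<bar>y\<bar> + 1)"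
    using t(1) by (intro mult_left_mono; simp)+
  ultimately have te: "t * \<bar>x\<bar> < e" "t * \<bar>y\<bar> < e"
    using \<open>0 < e\<close> by linarith+
  have shrink: "(1 - t) * z \<in> {-c..c}" if "z \<in> {-c..c}" for z c :: real
  proof -
    have "\<bar>(1 - t) * z\<bar> \<le> 1 * \<bar>z\<bar>" unfolding abs_mult using t by (intro mult_right_mono) auto
    then show ?thesis using that by auto
  qed
  have y: "y = 0"
  proof (rule ccontr)
    assume "y \<noteq> 0"
    have "dist (x, y) (x, (1 - t) * y) = t * \<bar>y\<bar>"
      using t by (simp add: dist_Pair_Pair dist_real_def algebra_simps abs_mult real_sqrt_mult)
    then have "trough N x y \<le> trough N x ((1 - t) * y)" using e xy shrink te by simp
    moreover have "trough N x ((1 - t) * y) = trough N x y - t * (\<bar>y\<bar> - x * y / real N)"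
    proof -
      have "\<bar>(1 - t) * y\<bar> = (1 - t) * \<bar>y\<bar>" using t by (simp add: abs_mult)
      moreover have "x * ((1 - t) * y) / real N = (1 - t) * (x * y / real N)" by simp
      moreover have "M + (1 - t) * u - (1 - t) * v = M + u - v - t * (u - v)" for M u v
        by (simp add: algebra_simps)
      ultimately show ?thesis by (simp only: trough_def of_nat_id)
    qed
    moreover have "0 < t * (\<bar>y\<bar> - x * y / real N)"
      by (intro mult_pos_pos t trough_snd_slope_pos) (use \<open>y \<noteq> 0\<close> xy assms in auto)
    ultimately show False by linarith
  qed
  have "\<bar>x\<bar> \<le> 1"
  proof (rule ccontr)
    assume "\<not> \<bar>x\<bar> \<le> 1"
    have "dist (x, y) ((1 - t) * x, y) = t * \<bar>x\<bar>"
      using t by (simp add: dist_Pair_Pair dist_real_def algebra_simps abs_mult real_sqrt_mult)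
    then have "trough N x y \<le> trough N ((1 - t) * x) y" using e xy shrink te by simp
    moreover have "\<bar>(1 - t) * x\<bar> = \<bar>x\<bar> - t * \<bar>x\<bar>"
      unfolding abs_mult using t by (simp add: algebra_simps)
    moreover have "0 < t * \<bar>x\<bar>" using t \<open>\<not> \<bar>x\<bar> \<le> 1\<close> by simp
    ultimately show False using \<open>\<not> \<bar>x\<bar> \<le> 1\<close> y by (simp add: trough_def max_def split: if_splits)
  qed
  then show "x \<in> {-1..1} \<and> y \<in> {0}" using y by auto
qed

theorem theorem4p1:
  fixes a b :: real
  assumes "computable_real a" and "computable_real b" and "a > 1" and "b > 0"
  shows "\<exists>f1 :: real \<times> real \<Rightarrow> real.
    computable_continuous_on ({-a..a} \<times> {-b..b}) f1 \<and>
    (\<forall>x2\<in>{-b..b}.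
       convex_on {-a..a} (\<lambda>x1. f1 (x1, x2)) \<and>
       piecewise_linear_on (-a) a 3 (\<lambda>x1. f1 (x1, x2)) \<and>
       (computable_real x2 \<longrightarrow> computable_continuous_on {-a..a} (\<lambda>x1. f1 (x1, x2)))) \<and>
    (\<forall>x1\<in>{-a..a}.
       convex_on {-b..b} (\<lambda>x2. f1 (x1, x2)) \<and>
       piecewise_linear_on (-b) b 2 (\<lambda>x2. f1 (x1, x2)) \<and>
       (computable_real x1 \<longrightarrow> computable_continuous_on {-b..b} (\<lambda>x2. f1 (x1, x2)))) \<and>
    local_minimizers ({-a..a} \<times> {-b..b}) f1 \<subseteq> global_minimizers ({-a..a} \<times> {-b..b}) f1 \<and>
    convex (global_minimizers ({-a..a} \<times> {-b..b}) f1) \<and>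
    (\<forall>x2\<in>{-b..b}. x2 \<noteq> 0 \<longrightarrow> (\<exists>!x1. x1 \<in> global_minimizers {-a..a} (\<lambda>x1. f1 (x1, x2)))) \<and>
    (\<forall>G1\<in>assignment_functions1 {-a..a} {-b..b} f1. \<not> turing_computable_on {-b..b} G1)"
proof -
  obtain N :: nat where "max (a + 1) (b + 1) \<le> real N" using real_arch_simple by blast
  then have N: "a + 1 \<le> real N" "b + 1 \<le> real N" by auto
  let ?f = "\<lambda>(x, y). trough N x y :: real"
  have cc: "computable_continuous_on ({-a..a} \<times> {-b..b}) ?f"
    by (rule computable_continuous_trough) (use assms N in auto)
  have Ra: "computable_rectangle {-a..a}" and Rb: "computable_rectangle {-b..b}"
    using assms by (auto intro: computable_rectangle_symmetric_interval)
  have gm: "global_minimizers ({-a..a} \<times> {-b..b}) ?f = {-1..1} \<times> {0}"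
    by (rule global_minimizers_trough) (use assms N in auto)
  have lm: "local_minimizers ({-a..a} \<times> {-b..b}) ?f \<subseteq> {-1..1} \<times> {0}"
    by (rule local_minimizers_trough) (use assms N in auto)
  have gm1: "global_minimizers {-a..a} (\<lambda>x. ?f (x, y)) = {sgn y}" if "y \<in> {-b..b}" "y \<noteq> 0" for y
    unfolding prod.case by (rule global_minimizers_trough_fst) (use that assms N in auto)
  have nc: "\<not> turing_computable_on {-b..b} G" if "G \<in> assignment_functions1 {-a..a} {-b..b} ?f" for G
  proof (rule sign_jump_not_turing_computable)
    have G: "G y = sgn y" if "y \<in> {-b..b}" "y \<noteq> 0" for y
      using \<open>G \<in> _\<close> gm1[OF that] that(1) unfolding assignment_functions1_def by auto
    show "G x = 1" if "0 < x" "x \<le> b" for x using G[of x] that by simp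
    show "G x = - 1" if "- b \<le> x" "x < 0" for x using G[of x] that assms(4) by simp
  qed (use assms in simp)
  show ?thesis
  proof (intro exI[of _ ?f] conjI ballI impI)
    fix y assume y: "y \<in> {-b..b}"
    show "convex_on {-a..a} (\<lambda>x. ?f (x, y))" "piecewise_linear_on (-a) a 3 (\<lambda>x. ?f (x, y))"
      unfolding prod.case using assms by (auto intro: convex_on_trough piecewise_linear_trough_fst)
    show "computable_continuous_on {-a..a} (\<lambda>x. ?f (x, y))" if "computable_real y"
      by (rule computable_continuous_on_isometric_pullback[OF cc Ra, where e = "\<lambda>x. (x, y)"])
        (use y that in \<open>auto simp: norm_Pair computable_vec_seq_Pair computable_vec_seq_real
          computable_real_seq_const\<close>)
    show "\<exists>!x. x \<in> global_minimizers {-a..a} (\<lambda>x. ?f (x, y))" if "y \<noteq> 0"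
      unfolding gm1[OF y that] by simp
  next
    fix x assume x: "x \<in> {-a..a}"
    show "convex_on {-b..b} (\<lambda>y. ?f (x, y))" "piecewise_linear_on (-b) b 2 (\<lambda>y. ?f (x, y))"
      unfolding prod.case using assms by (auto intro: convex_on_trough piecewise_linear_trough_snd)
    show "computable_continuous_on {-b..b} (\<lambda>y. ?f (x, y))" if "computable_real x"
      by (rule computable_continuous_on_isometric_pullback[OF cc Rb, where e = "\<lambda>y. (x, y)"])
        (use x that in \<open>auto simp: norm_Pair computable_vec_seq_Pair computable_vec_seq_real
          computable_real_seq_const\<close>)
  qed (use cc gm lm nc in \<open>auto intro!: convex_Times\<close>)
qed

end
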